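(* The renormalized multiple zeta values $\zeta_+$ are compatible with the meromorphic continuation of multiple zeta values, i.e., for every $k\in\mathbb{N}_0$ $$\zeta_+(-k)=\zeta_1(-k),$$ and for all integers $a,b\ge0$ with $a+b$ odd $$\zeta_+(-a,-b)=\zeta_2(-a,-b).$$
   Context: Meromorphic continuation: $\zeta_n(s_1,\dots,s_n)$ denotes the meromorphic continuation to $\mathbb{C}^n$ of $\sum_{m_1>\cdots>m_n>0}m_1^{-s_1}\cdots m_n^{-s_n}$ (absolutely convergent when $\sum_{j=1}^k\operatorname{Re}(s_j)>k$ for $k=1,\dots,n$). It is known that the singularities of $\zeta_1$ are at $s_1=1$, and those of $\zeta_2$ are at $s_1=1$ or $s_1+s_2\in\{2,1,0,-2,-4,\dots\}$. The Hopf algebra $\mathcal{H}_0$: Let $L=\{d,y\}$, $L^*$ the free monoid on $L$ with empty word $\mathbf{1}$, $\mathbb{Q}\langle L\rangle$ the free associative algebra, $\mathcal{T}_-:=\langle wd:w\in L^*\rangle_{\mathbb{Q}}$. The bilinear product $\diamond_0$ on $\mathbb{Q}\langle L\rangle$ is defined recursively on words by $\mathbf{1}\diamond_0 w=w\diamond_0\mathbf{1}=w$; $yu\diamond_0 v=u\diamond_0 yv=y(u\diamond_0 v)$; $du\diamond_0 dv=d(u\diamond_0 dv)-u\diamond_0 d^2v$. $\mathcal{L}_-$ is the two-sided ideal of $(\mathbb{Q}\langle L\rangle,\diamond_0)$ generated by $d^k\big(d(u\diamond_0 v)-du\diamond_0 v-u\diamond_0 dv\big)$, $k\in\mathbb{N}_0$,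 $u,v\in L^*$. $\mathcal{H}_0:=\mathbb{Q}\langle L\rangle/(\mathcal{L}_-+\mathcal{T}_-)$ is a commutative Hopf algebra with product induced by $\diamond_0$, coproduct $\Delta_0$ induced by the concatenation morphism $\overline{\Delta}_0$ with $\overline{\Delta}_0(y)=\mathbf{1}\otimes y+y\otimes\mathbf{1}$, $\overline{\Delta}_0(d)=\mathbf{1}\otimes d+d\otimes\mathbf{1}$, and counit $\varepsilon$ ($\varepsilon(\mathbf{1})=1$, zero on nonempty words); it is connected graded by depth (number of letters $y$). Words stand for their classes in $\mathcal{H}_0$. The character $\phi$: let $\mathcal{A}=\mathbb{Q}[z^{-1},z]]$ (Laurent series in $z$ with finite pole part), $\mathcal{A}_-=z^{-1}\mathbb{Q}[z^{-1}]$, $\mathcal{A}_+=\mathbb{Q}[[z]]$, $\mathcal{A}=\mathcal{A}_-\oplus\mathcal{A}_+$, and $\pi:\mathcal{A}\to\mathcal{A}_-$ the projection along $\mathcal{A}_+$ (pole part). Let $x(z)=\frac{e^z}{1-e^z}$. The algebra morphism $\phi:\mathcal{H}_0\to\mathcal{A}$ is given by $\phi(\mathbf{1})=1$ and $\phi(d^{k_1}y\cdots d^{k_n}y)(z)=\partial_z^{k_1}[x\,\partial_z^{k_2}[x\cdots\partial_z^{k_n}[x]\cdots]](z)$ for $k_i\in\mathbb{N}_0$. Birkhoff decomposition (Connes–Kreimer): with convolution $f\star g=m_{\mathcal{A}}(f\otimes g)\Delta_0$ and $e=\eta_{\mathcal{A}}\circ\varepsilon$, there is a unique decomposition $\phi=\phi_-^{\star(-1)}\star\phi_+$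 with characters $\phi_-:\mathcal{H}_0\to\mathbb{Q}\oplus\mathcal{A}_-$ and $\phi_+:\mathcal{H}_0\to\mathcal{A}_+$ such that $\phi_-=e-\pi(\phi_-\star(\phi-e))$ and $\phi_+=e+(\mathrm{Id}-\pi)(\phi_-\star(\phi-e))$. Renormalized MZVs: $\zeta_+(-k_1,\dots,-k_n):=\lim_{z\to0}\phi_+(d^{k_1}y\cdots d^{k_n}y)(z)$ for $k_1,\dots,k_n\in\mathbb{N}_0$, $n\ge1$ (i.e. the constant term). *)

theory Defs
  imports
    "HOL-Complex_Analysis.Complex_Analysis"
    "HOL-Computational_Algebra.Formal_Laurent_Series"
    "HOL-Library.Poly_Mapping"
begin

definition scale_free :: "rat \<Rightarrow> ('a \<Rightarrow>\<^sub>0 rat) \<Rightarrow> ('a \<Rightarrow>\<^sub>0 rat)" where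
  "scale_free c p = Poly_Mapping.map ((*) c) p"

definition basis :: "'a \<Rightarrow> ('a \<Rightarrow>\<^sub>0 rat)" where
  "basis w = Poly_Mapping.single w 1"

definition lin_ext :: "(rat \<Rightarrow> 'b \<Rightarrow> 'b) \<Rightarrow> ('a \<Rightarrow> 'b::ab_group_add) \<Rightarrow> ('a \<Rightarrow>\<^sub>0 rat) \<Rightarrow> 'b" where
  "lin_ext scl F p = (\<Sum>w\<in>Poly_Mapping.keys p. scl (Poly_Mapping.lookup p w) (F w))"

lemma lookup_scale_free [simp]:
  "Poly_Mapping.lookup (scale_free c p) w = c * Poly_Mapping.lookup p w"
  unfolding scale_free_def by transfer (simp add: when_def)

interpretation free: vector_space "scale_free :: rat \<Rightarrow> ('a \<Rightarrow>\<^sub>0 rat) \<Rightarrow> ('a \<Rightarrow>\<^sub>0 rat)"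
  by unfold_locales (rule poly_mapping_eqI; simp add: lookup_add algebra_simps)+

definition scale_fls :: "rat \<Rightarrow> rat fls \<Rightarrow> rat fls" where
  "scale_fls c f = fls_const c * f"

interpretation fls: vector_space scale_fls
  by unfold_locales
    (simp_all add: scale_fls_def distrib_left distrib_right mult.assoc
      flip: fls_plus_const fls_const_mult_const)

lemma lin_ext_superset:
  assumes "vector_space scl" "finite K" "Poly_Mapping.keys p \<subseteq> K"
  shows "lin_ext scl F p = (\<Sum>w\<in>K. scl (Poly_Mapping.lookup p w) (F w))"
proof -
  interpret vector_space scl by fact
  show ?thesis unfolding lin_ext_def
    by (intro sum.mono_neutral_left assms) (auto simp: in_keys_iff)
qed

lemma lin_ext_add:
  assumes "vector_space scl"
  shows "lin_ext scl F (p + q) = lin_ext scl F p + lin_ext scl F q"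
proof -
  interpret vector_space scl by fact
  let ?K = "Poly_Mapping.keys p \<union> Poly_Mapping.keys q"
  have "lin_ext scl F (p + q) = (\<Sum>w\<in>?K. scl (Poly_Mapping.lookup (p + q) w) (F w))"
    by (intro lin_ext_superset assms) (use Poly_Mapping.keys_add[of p q] in auto)
  also have "\<dots> = (\<Sum>w\<in>?K. scl (Poly_Mapping.lookup p w) (F w)) +
      (\<Sum>w\<in>?K. scl (Poly_Mapping.lookup q w) (F w))"
    by (simp add: lookup_add scale_left_distrib sum.distrib)
  also have "\<dots> = lin_ext scl F p + lin_ext scl F q"
    by (intro arg_cong2[where f = "(+)"] lin_ext_superset[symmetric] assms) auto
  finally show ?thesis .
qed

lemma lin_ext_scale:
  assumes "vector_space scl"
  shows "lin_ext scl F (scale_free c p) = scl c (lin_ext scl F p)"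
proof -
  interpret vector_space scl by fact
  have "lin_ext scl F (scale_free c p)
      = (\<Sum>w\<in>Poly_Mapping.keys p. scl (Poly_Mapping.lookup (scale_free c p) w) (F w))"
    by (intro lin_ext_superset assms) (auto simp: in_keys_iff)
  then show ?thesis by (simp add: lin_ext_def scale_sum_right)
qed

lemma linear_lin_ext:
  assumes "vector_space scl"
  shows "Vector_Spaces.linear scale_free scl (lin_ext scl F)"
  by (intro Vector_Spaces.linear.intro assms free.vector_space_axioms module_hom.intro
      module_hom_axioms.intro module_iff_vector_space[THEN iffD2])
    (simp_all add: lin_ext_add lin_ext_scale assms)

lemma lin_ext_basis [simp]:
  assumes "vector_space scl"
  shows "lin_ext scl F (basis w) = F w"
proof -
  interpret vector_space scl by fact
  show ?thesis by (simp add: lin_ext_def basis_def)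
qed

lemma lin_ext_zero [simp]: "lin_ext scl F 0 = 0"
  by (simp add: lin_ext_def)

lemma lin_ext_minus:
  assumes "vector_space scl"
  shows "lin_ext scl F (p - q) = lin_ext scl F p - lin_ext scl F q"
  using lin_ext_add[OF assms, of F "p - q" q] by simp

lemma lin_ext_basis_id: "lin_ext scale_free basis p = p"
  by (rule poly_mapping_eqI)
    (simp add: lin_ext_def basis_def Poly_Mapping.lookup_sum lookup_single when_def in_keys_iff
      if_distrib cong: if_cong)

lemma free_induct [case_names zero basis add scale]:
  fixes p :: "'a \<Rightarrow>\<^sub>0 rat"
  assumes "P 0" "\<And>w. P (basis w)" "\<And>p q. P p \<Longrightarrow> P q \<Longrightarrow> P (p + q)"
    "\<And>c p. P p \<Longrightarrow> P (scale_free c p)"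
  shows "P p"
proof -
  have "P (\<Sum>w\<in>K. scale_free (c w) (basis w))" if "finite K" for c :: "'a \<Rightarrow> rat" and K
    using that by (induction K) (auto intro: assms)
  from this[of "Poly_Mapping.keys p" "Poly_Mapping.lookup p"] show ?thesis
    using lin_ext_basis_id[of p] by (simp add: lin_ext_def)
qed

lemma lin_ext_fun_add:
  assumes "vector_space scl"
  shows "lin_ext scl (\<lambda>w. F w + G w) p = lin_ext scl F p + lin_ext scl G p"
proof -
  interpret vector_space scl by fact
  show ?thesis by (simp add: lin_ext_def scale_right_distrib sum.distrib)
qed

datatype letter = Ld | Ly

type_synonym word = "letter list"
type_synonym free_alg = "word \<Rightarrow>\<^sub>0 rat"

definition lmul :: "letter \<Rightarrow> free_alg \<Rightarrow> free_alg" where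
  "lmul a = lin_ext scale_free (\<lambda>w. basis (a # w))"

lemma lmul_simps [simp]:
  "lmul a (basis w) = basis (a # w)" "lmul a 0 = 0"
  "lmul a (p + q) = lmul a p + lmul a q" "lmul a (p - q) = lmul a p - lmul a q"
  "lmul a (scale_free c p) = scale_free c (lmul a p)"
  by (simp_all add: lmul_def lin_ext_add lin_ext_minus lin_ext_scale free.vector_space_axioms)

text \<open>
  In the overlapping case \<open>yu \<diamondop>\<^sub>0 yv\<close> the defining equations give \<open>y(yu \<diamondop>\<^sub>0 v)\<close> and
  \<open>y(u \<diamondop>\<^sub>0 yv)\<close>, both equal to \<open>yy(u \<diamondop>\<^sub>0 v)\<close>; the recursion picks one of them and
  \<open>diamond_word_Ly_right\<close> recovers the other equation.
\<close>

function (sequential) diamond_word :: "word \<Rightarrow> word \<Rightarrow> free_alg" where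
  "diamond_word [] v = basis v"
| "diamond_word u [] = basis u"
| "diamond_word (Ly # u) v = lmul Ly (diamond_word u v)"
| "diamond_word u (Ly # v) = lmul Ly (diamond_word u v)"
| "diamond_word (Ld # u) (Ld # v) =
     lmul Ld (diamond_word u (Ld # v)) - diamond_word u (Ld # Ld # v)"
  by pat_completeness auto
termination
  by (relation "measures [\<lambda>(u, v). count_list (u @ v) Ly, \<lambda>(u, v). length u]") auto

lemma diamond_word_Nil_right [simp]: "diamond_word u [] = basis u"
  by (cases u) simp_all

lemma diamond_word_Ly_left [simp]: "diamond_word (Ly # u) v = lmul Ly (diamond_word u v)"
  by (cases v) simp_all

lemma diamond_word_Ly_right [simp]: "diamond_word u (Ly # v) = lmul Ly (diamond_word u v)"
proof (induction u)
  case (Cons a u)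
  then show ?case by (cases a) simp_all
qed simp

definition diamond :: "free_alg \<Rightarrow> free_alg \<Rightarrow> free_alg" (infixl \<open>\<diamondop>\<^sub>0\<close> 70) where
  "p \<diamondop>\<^sub>0 q = lin_ext scale_free (\<lambda>u. lin_ext scale_free (diamond_word u) q) p"

lemma diamond_left_simps [simp]:
  "0 \<diamondop>\<^sub>0 q = 0"
  "(p + p') \<diamondop>\<^sub>0 q = p \<diamondop>\<^sub>0 q + p' \<diamondop>\<^sub>0 q"
  "(p - p') \<diamondop>\<^sub>0 q = p \<diamondop>\<^sub>0 q - p' \<diamondop>\<^sub>0 q"
  "scale_free c p \<diamondop>\<^sub>0 q = scale_free c (p \<diamondop>\<^sub>0 q)"
  by (simp_all add: diamond_def lin_ext_add lin_ext_minus lin_ext_scale free.vector_space_axioms)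

lemma diamond_basis_left: "basis u \<diamondop>\<^sub>0 q = lin_ext scale_free (diamond_word u) q"
  by (simp add: diamond_def free.vector_space_axioms)

lemma diamond_basis [simp]: "basis u \<diamondop>\<^sub>0 basis v = diamond_word u v"
  by (simp add: diamond_basis_left free.vector_space_axioms)

lemma diamond_right_simps [simp]:
  "p \<diamondop>\<^sub>0 0 = 0"
  "p \<diamondop>\<^sub>0 (q + q') = p \<diamondop>\<^sub>0 q + p \<diamondop>\<^sub>0 q'"
  "p \<diamondop>\<^sub>0 (q - q') = p \<diamondop>\<^sub>0 q - p \<diamondop>\<^sub>0 q'"
  "p \<diamondop>\<^sub>0 scale_free c q = scale_free c (p \<diamondop>\<^sub>0 q)"
  by (induction p rule: free_induct,
      simp_all add: lin_ext_add lin_ext_minus lin_ext_scale free.vector_space_axioms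
        free.scale_right_distrib free.scale_right_diff_distrib free.scale_left_commute
        diamond_basis_left)

lemma diamond_lmul_Ly: "lmul Ly p \<diamondop>\<^sub>0 q = lmul Ly (p \<diamondop>\<^sub>0 q)"
proof (induction p rule: free_induct)
  case (basis u)
  show ?case by (induction q rule: free_induct) simp_all
qed simp_all

definition two_sided_ideal :: "free_alg set \<Rightarrow> bool" where
  "two_sided_ideal J \<longleftrightarrow> free.subspace J \<and> (\<forall>p\<in>J. \<forall>q. q \<diamondop>\<^sub>0 p \<in> J \<and> p \<diamondop>\<^sub>0 q \<in> J)"

definition leibniz_gen :: "word \<Rightarrow> word \<Rightarrow> free_alg" where
  "leibniz_gen u v =
     lmul Ld (basis u \<diamondop>\<^sub>0 basis v) - basis (Ld # u) \<diamondop>\<^sub>0 basis v - basis u \<diamondop>\<^sub>0 basis (Ld # v)"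

definition L_minus :: "free_alg set" where
  "L_minus = two_sided_ideal hull {(lmul Ld ^^ k) (leibniz_gen u v) | k u v. True}"

definition T_minus :: "free_alg set" where
  "T_minus = free.span {basis (w @ [Ld]) | w. True}"

definition LT_minus :: "free_alg set" where
  "LT_minus = {p + q | p q. p \<in> L_minus \<and> q \<in> T_minus}"

lemma two_sided_ideal_L_minus: "two_sided_ideal L_minus"
  unfolding L_minus_def
proof (rule hull_in)
  fix T assume T: "Ball T two_sided_ideal"
  show "two_sided_ideal (\<Inter> T)"
    unfolding two_sided_ideal_def
  proof (intro conjI ballI allI)
    show "free.subspace (\<Inter> T)"
      using T by (intro free.subspace_Inter) (simp add: two_sided_ideal_def)
    show "q \<diamondop>\<^sub>0 p \<in> \<Inter> T" "p \<diamondop>\<^sub>0 q \<in> \<Inter> T" if "p \<in> \<Inter> T" for p q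
      using T that by (simp_all add: two_sided_ideal_def)
  qed
qed

lemma subspace_L_minus: "free.subspace L_minus"
  using two_sided_ideal_L_minus by (simp add: two_sided_ideal_def)

lemma L_minus_diamond: "p \<in> L_minus \<Longrightarrow> q \<diamondop>\<^sub>0 p \<in> L_minus" "p \<in> L_minus \<Longrightarrow> p \<diamondop>\<^sub>0 q \<in> L_minus"
  using two_sided_ideal_L_minus by (simp_all add: two_sided_ideal_def)

lemma L_minus_gen: "(lmul Ld ^^ k) (leibniz_gen u v) \<in> L_minus"
  unfolding L_minus_def by (rule hull_inc) blast

lemma leibniz_L_minus:
  "lmul Ld (p \<diamondop>\<^sub>0 q) - lmul Ld p \<diamondop>\<^sub>0 q - p \<diamondop>\<^sub>0 lmul Ld q \<in> L_minus" (is "?l p q \<in> _")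
proof -
  note sub = subspace_L_minus
  have add: "?l (p + p') q = ?l p q + ?l p' q" "?l p (q + q') = ?l p q + ?l p q'" for p p' q q'
    by simp_all
  have scale: "?l (scale_free c p) q = scale_free c (?l p q)"
    "?l p (scale_free c q) = scale_free c (?l p q)" for c p q
    by (simp_all add: free.scale_right_diff_distrib)
  have "?l (basis u) q \<in> L_minus" for u
  proof (induction q rule: free_induct)
    case (basis v)
    then show ?case using L_minus_gen[of 0 u v] unfolding leibniz_gen_def by simp
  next
    case (add p q)
    then show ?case unfolding \<open>\<And>q' q p. ?l p (q + q') = ?l p q + ?l p q'\<close>
      using free.subspace_add[OF sub] by blast
  next
    case (scale c p)
    then show ?case unfolding \<open>\<And>c p q. ?l p (scale_free c q) = scale_free c (?l p q)\<close>
      using free.subspace_scale[OF sub] by blast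
  qed (use free.subspace_0[OF sub] in simp)
  then show ?thesis
  proof (induction p rule: free_induct)
    case (add p q)
    then show ?case unfolding \<open>\<And>p' q p. ?l (p + p') q = ?l p q + ?l p' q\<close>
      using free.subspace_add[OF sub] by blast
  next
    case (scale c p)
    then show ?case unfolding \<open>\<And>c p q. ?l (scale_free c p) q = scale_free c (?l p q)\<close>
      using free.subspace_scale[OF sub] by blast
  qed (use free.subspace_0[OF sub] in simp_all)
qed

lemma L_minus_induct [consumes 1, case_names gen zero add scale left right]:
  assumes "p \<in> L_minus"
    and "\<And>k u v. P ((lmul Ld ^^ k) (leibniz_gen u v))"
    and "P 0" "\<And>p q. p \<in> L_minus \<Longrightarrow> q \<in> L_minus \<Longrightarrow> P p \<Longrightarrow> P q \<Longrightarrow> P (p + q)"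
    and "\<And>c p. p \<in> L_minus \<Longrightarrow> P p \<Longrightarrow> P (scale_free c p)"
    and "\<And>p q. p \<in> L_minus \<Longrightarrow> P p \<Longrightarrow> P (q \<diamondop>\<^sub>0 p)" "\<And>p q. p \<in> L_minus \<Longrightarrow> P p \<Longrightarrow> P (p \<diamondop>\<^sub>0 q)"
  shows "P p"
proof -
  let ?S = "{p. p \<in> L_minus \<and> P p}"
  have "two_sided_ideal ?S"
    unfolding two_sided_ideal_def free.subspace_def
    using assms(3-) L_minus_diamond free.subspace_0[OF subspace_L_minus]
      free.subspace_add[OF subspace_L_minus] free.subspace_scale[OF subspace_L_minus]
    by simp
  moreover have "{(lmul Ld ^^ k) (leibniz_gen u v) | k u v. True} \<subseteq> ?S"
    using assms(2) L_minus_gen by blast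
  ultimately have "L_minus \<subseteq> ?S"
    unfolding L_minus_def by (intro hull_minimal)
  then show ?thesis using assms(1) by blast
qed

lemma L_minus_lmul:
  assumes "p \<in> L_minus"
  shows "lmul a p \<in> L_minus"
proof (cases a)
  case Ly
  have "diamond_word [] = basis" by (rule ext) simp
  then have "lmul Ly p = basis [Ly] \<diamondop>\<^sub>0 p"
    using diamond_lmul_Ly[of "basis []" p] by (simp add: diamond_basis_left lin_ext_basis_id)
  then show ?thesis using Ly L_minus_diamond(1)[OF assms, of "basis [Ly]"] by simp
next
  case Ld
  have eq: "lmul Ld (p \<diamondop>\<^sub>0 q) = (lmul Ld (p \<diamondop>\<^sub>0 q) - lmul Ld p \<diamondop>\<^sub>0 q - p \<diamondop>\<^sub>0 lmul Ld q) +
      lmul Ld p \<diamondop>\<^sub>0 q + p \<diamondop>\<^sub>0 lmul Ld q" for p q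
    by simp
  note sub = free.subspace_add[OF subspace_L_minus] free.subspace_scale[OF subspace_L_minus]
  have "lmul Ld p \<in> L_minus" using assms
  proof (induction rule: L_minus_induct)
    case (gen k u v)
    then show ?case using L_minus_gen[of "Suc k" u v] by simp
  next
    case (left p q)
    show ?case by (subst eq) (intro sub leibniz_L_minus L_minus_diamond left)
  next
    case (right p q)
    show ?case by (subst eq) (intro sub leibniz_L_minus L_minus_diamond right)
  qed (simp_all add: sub free.subspace_0[OF subspace_L_minus])
  then show ?thesis using Ld by simp
qed

lemma T_minus_basis: "basis (w @ [Ld]) \<in> T_minus"
proof -
  have "basis (w @ [Ld]) \<in> {basis (w @ [Ld]) | w. True}" by blast
  then show ?thesis unfolding T_minus_def by (rule free.span_base)
qed

lemma subspace_T_minus: "free.subspace T_minus"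
  unfolding T_minus_def by (rule free.subspace_span)

lemma T_minus_induct [consumes 1, case_names zero basis add scale]:
  assumes "p \<in> T_minus" "P 0" "\<And>w. P (basis (w @ [Ld]))"
    "\<And>p q. P p \<Longrightarrow> P q \<Longrightarrow> P (p + q)" "\<And>c p. P p \<Longrightarrow> P (scale_free c p)"
  shows "P p"
proof -
  have "free.subspace {p. P p}"
    using assms(2,4,5) by (simp add: free.subspace_def)
  moreover have "{basis (w @ [Ld]) | w. True} \<subseteq> {p. P p}"
    using assms(3) by blast
  ultimately have "T_minus \<subseteq> {p. P p}"
    unfolding T_minus_def by (intro free.span_minimal)
  then show ?thesis using assms(1) by blast
qed

lemma T_minus_lmul:
  assumes "p \<in> T_minus"
  shows "lmul a p \<in> T_minus"
  using assms
proof (induction rule: T_minus_induct)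
  case (basis w)
  then show ?case using T_minus_basis[of "a # w"] by simp
qed (simp_all add: free.subspace_0[OF subspace_T_minus] free.subspace_add[OF subspace_T_minus]
    free.subspace_scale[OF subspace_T_minus])

definition ends_Ld :: "word \<Rightarrow> bool" where
  "ends_Ld w \<longleftrightarrow> (\<exists>w'. w = w' @ [Ld])"

lemma ends_Ld_Nil: "\<not> ends_Ld []"
  by (simp add: ends_Ld_def)

lemma ends_Ld_Cons: "ends_Ld (a # w) \<longleftrightarrow> w = [] \<and> a = Ld \<or> ends_Ld w"
  unfolding ends_Ld_def by (auto simp: Cons_eq_append_conv)

lemma diamond_word_T_minus: "ends_Ld u \<or> ends_Ld v \<Longrightarrow> diamond_word u v \<in> T_minus"
proof (induction u v rule: diamond_word.induct)
  case (1 v)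
  then show ?case by (auto simp: ends_Ld_Nil ends_Ld_def T_minus_basis)
next
  case (2 a u)
  then show ?case
    by (metis diamond_word.simps(2) ends_Ld_Nil ends_Ld_def T_minus_basis)
next
  case (3 u b v)
  then have "ends_Ld u \<or> ends_Ld (b # v)" by (simp add: ends_Ld_Cons)
  then show ?case unfolding diamond_word_Ly_left by (intro T_minus_lmul 3)
next
  case (4 u v)
  then have "ends_Ld (Ld # u) \<or> ends_Ld v" by (simp add: ends_Ld_Cons)
  then show ?case unfolding diamond_word.simps(4) by (intro T_minus_lmul 4)
next
  case (5 u v)
  show ?case
  proof (cases "u = []")
    case True
    then show ?thesis using free.subspace_0[OF subspace_T_minus] by simp
  next
    case False
    then have "ends_Ld u \<or> ends_Ld (Ld # v)" "ends_Ld u \<or> ends_Ld (Ld # Ld # v)"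
      using 5(3) by (auto simp: ends_Ld_Cons)
    then show ?thesis unfolding diamond_word.simps(5)
      by (intro free.subspace_diff[OF subspace_T_minus] T_minus_lmul 5)
  qed
qed

lemma T_minus_diamond:
  assumes "p \<in> T_minus"
  shows "q \<diamondop>\<^sub>0 p \<in> T_minus" "p \<diamondop>\<^sub>0 q \<in> T_minus"
proof -
  note sub = free.subspace_0[OF subspace_T_minus] free.subspace_add[OF subspace_T_minus]
    free.subspace_scale[OF subspace_T_minus]
  have T: "diamond_word u (w @ [Ld]) \<in> T_minus" "diamond_word (w @ [Ld]) u \<in> T_minus" for u w
    by (auto intro!: diamond_word_T_minus simp: ends_Ld_def)
  have "basis u \<diamondop>\<^sub>0 p \<in> T_minus" for u using assms
    by (induction rule: T_minus_induct) (simp_all add: sub T)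
  then show "q \<diamondop>\<^sub>0 p \<in> T_minus"
    by (induction q rule: free_induct) (simp_all add: sub)
  have "p \<diamondop>\<^sub>0 basis u \<in> T_minus" for u using assms
    by (induction rule: T_minus_induct) (simp_all add: sub T)
  then show "p \<diamondop>\<^sub>0 q \<in> T_minus"
    by (induction q rule: free_induct) (simp_all add: sub)
qed

lemma subspace_LT_minus: "free.subspace LT_minus"
  unfolding LT_minus_def using free.subspace_sums[OF subspace_L_minus subspace_T_minus] .

lemma two_sided_ideal_LT_minus: "two_sided_ideal LT_minus"
  unfolding two_sided_ideal_def
proof (intro conjI subspace_LT_minus ballI allI)
  fix p q assume "p \<in> LT_minus"
  then obtain l t where p: "p = l + t" and "l \<in> L_minus" "t \<in> T_minus"
    unfolding LT_minus_def by blast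
  then have "q \<diamondop>\<^sub>0 l \<in> L_minus" "l \<diamondop>\<^sub>0 q \<in> L_minus" "q \<diamondop>\<^sub>0 t \<in> T_minus" "t \<diamondop>\<^sub>0 q \<in> T_minus"
    by (simp_all add: L_minus_diamond T_minus_diamond)
  then show "q \<diamondop>\<^sub>0 p \<in> LT_minus" "p \<diamondop>\<^sub>0 q \<in> LT_minus"
    unfolding p LT_minus_def diamond_left_simps diamond_right_simps by blast+
qed

lemma L_minus_subset: "L_minus \<subseteq> LT_minus"
proof
  fix p assume "p \<in> L_minus"
  then have "p = p + 0 \<and> p \<in> L_minus \<and> 0 \<in> T_minus"
    using free.subspace_0[OF subspace_T_minus] by simp
  then show "p \<in> LT_minus" unfolding LT_minus_def by blast
qed

lemma T_minus_subset: "T_minus \<subseteq> LT_minus"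
proof
  fix p assume "p \<in> T_minus"
  then have "p = 0 + p \<and> 0 \<in> L_minus \<and> p \<in> T_minus"
    using free.subspace_0[OF subspace_L_minus] by simp
  then show "p \<in> LT_minus" unfolding LT_minus_def by blast
qed

definition h0_rel :: "free_alg \<Rightarrow> free_alg \<Rightarrow> bool" where
  "h0_rel p q \<longleftrightarrow> p - q \<in> LT_minus"

lemma equivp_h0_rel: "equivp h0_rel"
proof (rule equivpI)
  show "reflp h0_rel"
    by (auto simp: reflp_def h0_rel_def free.subspace_0[OF subspace_LT_minus])
  show "symp h0_rel"
  proof (rule sympI)
    fix p q assume "h0_rel p q"
    then show "h0_rel q p"
      using free.subspace_neg[OF subspace_LT_minus, of "p - q"] by (simp add: h0_rel_def)
  qed
  show "transp h0_rel"
  proof (rule transpI)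
    fix p q r assume "h0_rel p q" "h0_rel q r"
    then show "h0_rel p r"
      using free.subspace_add[OF subspace_LT_minus, of "p - q" "q - r"] by (simp add: h0_rel_def)
  qed
qed

quotient_type h0 = free_alg / h0_rel
  by (rule equivp_h0_rel)

lemma h0_rel_refl: "h0_rel p p"
  by (rule equivp_reflp[OF equivp_h0_rel])

instantiation h0 :: "{ab_group_add, times, one}"
begin

lift_definition zero_h0 :: h0 is 0 .

lift_definition one_h0 :: h0 is "basis []" .

lift_definition plus_h0 :: "h0 \<Rightarrow> h0 \<Rightarrow> h0" is "(+)"
proof -
  fix p p' q q' assume "h0_rel p p'" "h0_rel q q'"
  then show "h0_rel (p + q) (p' + q')"
    using free.subspace_add[OF subspace_LT_minus, of "p - p'" "q - q'"]
    by (simp add: h0_rel_def algebra_simps)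
qed

lift_definition minus_h0 :: "h0 \<Rightarrow> h0 \<Rightarrow> h0" is "(-)"
proof -
  fix p p' q q' assume "h0_rel p p'" "h0_rel q q'"
  then show "h0_rel (p - q) (p' - q')"
    using free.subspace_diff[OF subspace_LT_minus, of "p - p'" "q - q'"]
    by (simp add: h0_rel_def algebra_simps)
qed

lift_definition uminus_h0 :: "h0 \<Rightarrow> h0" is uminus
proof -
  fix p p' assume "h0_rel p p'"
  then show "h0_rel (- p) (- p')"
    using free.subspace_neg[OF subspace_LT_minus, of "p - p'"] by (simp add: h0_rel_def)
qed

lift_definition times_h0 :: "h0 \<Rightarrow> h0 \<Rightarrow> h0" is "(\<diamondop>\<^sub>0)"
proof -
  fix p p' q q' assume "h0_rel p p'" "h0_rel q q'"
  then have "(p - p') \<diamondop>\<^sub>0 q \<in> LT_minus" "p' \<diamondop>\<^sub>0 (q - q') \<in> LT_minus"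
    using two_sided_ideal_LT_minus unfolding two_sided_ideal_def h0_rel_def by blast+
  then have "(p - p') \<diamondop>\<^sub>0 q + p' \<diamondop>\<^sub>0 (q - q') \<in> LT_minus"
    by (rule free.subspace_add[OF subspace_LT_minus])
  then show "h0_rel (p \<diamondop>\<^sub>0 q) (p' \<diamondop>\<^sub>0 q')"
    unfolding h0_rel_def by simp
qed

instance
  by standard (transfer; simp add: algebra_simps h0_rel_refl)+

end

lift_definition scale_h0 :: "rat \<Rightarrow> h0 \<Rightarrow> h0" is scale_free
proof -
  fix c p p' assume "h0_rel p p'"
  then show "h0_rel (scale_free c p) (scale_free c p')"
    using free.subspace_scale[OF subspace_LT_minus, of "p - p'" c]
    by (simp add: h0_rel_def free.scale_right_diff_distrib)
qed

interpretation h0: vector_space scale_h0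
  by unfold_locales
    (transfer; simp add: free.scale_right_distrib free.scale_left_distrib h0_rel_refl)+

definition h0_word :: "word \<Rightarrow> h0" where
  "h0_word w = abs_h0 (basis w)"

lemma lin_ext_LT_minus:
  assumes scl: "vector_space scl"
    and L: "\<And>p. p \<in> L_minus \<Longrightarrow> lin_ext scl F p = 0" and T: "\<And>w. F (w @ [Ld]) = 0"
    and p: "p \<in> LT_minus"
  shows "lin_ext scl F p = 0"
proof -
  interpret vector_space scl by fact
  have "lin_ext scl F t = 0" if "t \<in> T_minus" for t
    using that
    by (induction rule: T_minus_induct) (simp_all add: lin_ext_add lin_ext_scale scl T)
  then show ?thesis
    using p L unfolding LT_minus_def by (auto simp: lin_ext_add scl)
qed

lemma lin_ext_h0_rel:
  assumes "vector_space scl" "\<And>p. p \<in> LT_minus \<Longrightarrow> lin_ext scl F p = 0" "h0_rel p q"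
  shows "lin_ext scl F p = lin_ext scl F q"
  using assms(2)[of "p - q"] assms(1,3) by (simp add: lin_ext_minus h0_rel_def)

lemma lookup_lmul_Nil [simp]: "Poly_Mapping.lookup (lmul a p) [] = 0"
  by (induction p rule: free_induct) (simp_all add: basis_def lookup_single lookup_add
    lmul_simps(1)[unfolded basis_def])

lemma lookup_diamond_word_Nil:
  "Poly_Mapping.lookup (diamond_word u v) [] = (if u = [] \<and> v = [] then 1 else 0)"
  by (induction u v rule: diamond_word.induct)
    (simp_all add: basis_def lookup_single lookup_minus)

lemma lookup_diamond_Nil:
  "Poly_Mapping.lookup (p \<diamondop>\<^sub>0 q) [] = Poly_Mapping.lookup p [] * Poly_Mapping.lookup q []"
proof (induction p rule: free_induct)
  case (basis u)
  show ?case
    by (induction q rule: free_induct)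
      (simp_all add: lookup_add lookup_diamond_word_Nil algebra_simps,
        simp add: basis_def lookup_single when_def)
qed (simp_all add: lookup_add algebra_simps)

lemma lookup_L_minus_Nil: "p \<in> L_minus \<Longrightarrow> Poly_Mapping.lookup p [] = 0"
proof (induction rule: L_minus_induct)
  case (gen k u v)
  show ?case
    by (cases k)
      (simp_all add: leibniz_gen_def lookup_minus lookup_diamond_word_Nil)
qed (simp_all add: lookup_add lookup_diamond_Nil)

lemma lookup_T_minus_Nil: "p \<in> T_minus \<Longrightarrow> Poly_Mapping.lookup p [] = 0"
  by (induction rule: T_minus_induct) (simp_all add: lookup_add, simp add: basis_def lookup_single)

lift_definition counit :: "h0 \<Rightarrow> rat" is "\<lambda>p. Poly_Mapping.lookup p []"
proof -
  fix p q assume "h0_rel p q"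
  then obtain l t where "p - q = l + t" "l \<in> L_minus" "t \<in> T_minus"
    unfolding h0_rel_def LT_minus_def by blast
  then have "Poly_Mapping.lookup (p - q) [] = 0"
    by (simp add: lookup_add lookup_L_minus_Nil lookup_T_minus_Nil)
  then show "Poly_Mapping.lookup p [] = Poly_Mapping.lookup q []"
    by (simp add: lookup_minus)
qed

text \<open>The expansion of \<open>x(z) = e\<^sup>z / (1 - e\<^sup>z)\<close> at \<open>z = 0\<close>.\<close>

definition x_fls :: "rat fls" where
  "x_fls = fps_to_fls (fps_exp 1) / (1 - fps_to_fls (fps_exp 1))"

primrec phi_word :: "word \<Rightarrow> rat fls" where
  "phi_word [] = 1"
| "phi_word (a # w) = (case a of Ld \<Rightarrow> fls_deriv (phi_word w) | Ly \<Rightarrow> x_fls * phi_word w)"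

definition phi_free :: "free_alg \<Rightarrow> rat fls" where
  "phi_free = lin_ext scale_fls phi_word"

lemma phi_free_simps [simp]:
  "phi_free 0 = 0" "phi_free (p + q) = phi_free p + phi_free q"
  "phi_free (p - q) = phi_free p - phi_free q"
  "phi_free (scale_free c p) = scale_fls c (phi_free p)" "phi_free (basis w) = phi_word w"
  by (simp_all add: phi_free_def lin_ext_add lin_ext_minus lin_ext_scale fls.vector_space_axioms)

lemma phi_free_lmul [simp]:
  "phi_free (lmul Ld p) = fls_deriv (phi_free p)" "phi_free (lmul Ly p) = x_fls * phi_free p"
  by (induction p rule: free_induct; simp add: scale_fls_def algebra_simps)+

lemma phi_free_diamond_word: "phi_free (diamond_word u v) = phi_word u * phi_word v"
  by (induction u v rule: diamond_word.induct) (simp_all add: algebra_simps)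

lemma phi_free_diamond: "phi_free (p \<diamondop>\<^sub>0 q) = phi_free p * phi_free q"
proof (induction p rule: free_induct)
  case (basis u)
  show ?case
    by (induction q rule: free_induct)
      (simp_all add: phi_free_diamond_word scale_fls_def algebra_simps)
qed (simp_all add: scale_fls_def algebra_simps)

lemma phi_free_L_minus: "p \<in> L_minus \<Longrightarrow> phi_free p = 0"
proof (induction rule: L_minus_induct)
  case (gen k u v)
  have "phi_free (leibniz_gen u v) = 0"
    by (simp add: leibniz_gen_def phi_free_diamond_word algebra_simps)
  then show ?case by (induction k) simp_all
qed (simp_all add: phi_free_diamond)

lemma phi_word_append_Ld: "phi_word (w @ [Ld]) = 0"
  by (induction w) (simp_all split: letter.split)

lift_definition phi :: "h0 \<Rightarrow> rat fls" is phi_free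
proof -
  fix p q assume "h0_rel p q"
  moreover have "lin_ext scale_fls phi_word r = 0" if "r \<in> LT_minus" for r
    using lin_ext_LT_minus[OF fls.vector_space_axioms _ _ that, of phi_word]
      phi_free_L_minus phi_word_append_Ld by (simp add: phi_free_def)
  ultimately show "phi_free p = phi_free q"
    unfolding phi_free_def by (intro lin_ext_h0_rel fls.vector_space_axioms)
qed

definition dy_word :: "nat list \<Rightarrow> word" where
  "dy_word ks = concat (map (\<lambda>k. replicate k Ld @ [Ly]) ks)"

lemma phi_dy_word_Nil: "phi (h0_word (dy_word [])) = 1"
  by (simp add: dy_word_def h0_word_def phi.abs_eq)

lemma phi_dy_word_Cons:
  "phi (h0_word (dy_word (k # ks))) = (fls_deriv ^^ k) (x_fls * phi (h0_word (dy_word ks)))"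
proof -
  have "phi_word (replicate k Ld @ w) = (fls_deriv ^^ k) (phi_word w)" for w
    by (induction k) simp_all
  then show ?thesis by (simp add: dy_word_def h0_word_def phi.abs_eq)
qed

text \<open>
  \<open>\<rat>\<langle>L\<rangle> \<otimes> \<rat>\<langle>L\<rangle>\<close> is realised as the vector space with basis the pairs of words, \<open>(u, v)\<close>
  standing for \<open>u \<otimes> v\<close>.
\<close>

definition lmul_primitive :: "letter \<Rightarrow> (word \<times> word \<Rightarrow>\<^sub>0 rat) \<Rightarrow> (word \<times> word \<Rightarrow>\<^sub>0 rat)" where
  "lmul_primitive a = lin_ext scale_free (\<lambda>(u, v). basis (u, a # v) + basis (a # u, v))"

primrec coprod_word :: "word \<Rightarrow> (word \<times> word \<Rightarrow>\<^sub>0 rat)" where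
  "coprod_word [] = basis ([], [])"
| "coprod_word (a # w) = lmul_primitive a (coprod_word w)"

definition coprod :: "free_alg \<Rightarrow> (word \<times> word \<Rightarrow>\<^sub>0 rat)" where
  "coprod = lin_ext scale_free coprod_word"

text \<open>
  \<open>f \<star> g = m (f \<otimes> g) \<Delta>\<^sub>0\<close>, computed on a representative; that the value does not depend on the
  representative (\<open>\<Delta>\<^sub>0\<close> descends to the quotient) is lemma \<open>star_abs_h0\<close>.
\<close>

definition star :: "(h0 \<Rightarrow> rat fls) \<Rightarrow> (h0 \<Rightarrow> rat fls) \<Rightarrow> h0 \<Rightarrow> rat fls" (infixl \<open>\<star>\<close> 70) where
  "(f \<star> g) x =
     lin_ext scale_fls (\<lambda>(u, v). f (h0_word u) * g (h0_word v)) (coprod (rep_h0 x))"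

abbreviation ext :: "('a \<Rightarrow> rat fls) \<Rightarrow> ('a \<Rightarrow>\<^sub>0 rat) \<Rightarrow> rat fls" where
  "ext \<equiv> lin_ext scale_fls"

lemmas ext_simps [simp] =
  lin_ext_add[OF fls.vector_space_axioms] lin_ext_minus[OF fls.vector_space_axioms]
  lin_ext_scale[OF fls.vector_space_axioms] lin_ext_basis[OF fls.vector_space_axioms]

lemma ext_lmul [simp]: "ext f (lmul a p) = ext (\<lambda>w. f (a # w)) p"
  by (induction p rule: free_induct) simp_all

primrec conv_word :: "(word \<Rightarrow> rat fls) \<Rightarrow> (word \<Rightarrow> rat fls) \<Rightarrow> word \<Rightarrow> rat fls" where
  "conv_word f g [] = f [] * g []"
| "conv_word f g (a # w) = conv_word (\<lambda>u. f (a # u)) g w + conv_word f (\<lambda>u. g (a # u)) w"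

lemma ext_fun_add [simp]: "ext (\<lambda>w. F w + G w) p = ext F p + ext G p"
  by (rule lin_ext_fun_add[OF fls.vector_space_axioms])

lemma ext_lmul_primitive:
  "ext \<Phi> (lmul_primitive a t) = ext (\<lambda>(u, v). \<Phi> (u, a # v) + \<Phi> (a # u, v)) t"
  unfolding lmul_primitive_def
  by (induction t rule: free_induct)
    (auto simp: lin_ext_add lin_ext_scale free.vector_space_axioms split: prod.split)

lemma ext_coprod_word: "ext (\<lambda>(u, v). f u * g v) (coprod_word w) = conv_word f g w"
proof (induction w arbitrary: f g)
  case (Cons a w)
  have "ext (\<lambda>(u, v). f u * g v) (coprod_word (a # w)) =
      ext (\<lambda>x. (case x of (u, v) \<Rightarrow> f u * g (a # v)) + (case x of (u, v) \<Rightarrow> f (a # u) * g v))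
        (coprod_word w)"
    by (simp add: ext_lmul_primitive case_prod_unfold)
  also have "\<dots> = conv_word f g (a # w)"
    unfolding ext_fun_add Cons.IH[of f "\<lambda>v. g (a # v)"] Cons.IH[of "\<lambda>u. f (a # u)" g] by simp
  finally show ?case .
qed simp

lemma ext_coprod: "ext (\<lambda>(u, v). f u * g v) (coprod p) = ext (conv_word f g) p"
  unfolding coprod_def
  by (induction p rule: free_induct)
    (simp_all add: lin_ext_add lin_ext_scale free.vector_space_axioms ext_coprod_word)

primrec conv2 :: "(word \<Rightarrow> word \<Rightarrow> rat fls) \<Rightarrow> (word \<Rightarrow> word \<Rightarrow> rat fls) \<Rightarrow>
    word \<Rightarrow> word \<Rightarrow> rat fls" where
  "conv2 \<Phi> \<Psi> [] v = conv_word (\<Phi> []) (\<Psi> []) v"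
| "conv2 \<Phi> \<Psi> (a # u) v = conv2 (\<lambda>u. \<Phi> (a # u)) \<Psi> u v + conv2 \<Phi> (\<lambda>u. \<Psi> (a # u)) u v"

lemma conv2_Cons_right:
  "conv2 \<Phi> \<Psi> u (b # v) =
     conv2 (\<lambda>u v. \<Phi> u (b # v)) \<Psi> u v + conv2 \<Phi> (\<lambda>u v. \<Psi> u (b # v)) u v"
  by (induction u arbitrary: \<Phi> \<Psi>) (simp_all add: algebra_simps)

lemma conv2_flip: "conv2 \<Phi> \<Psi> u v = conv2 (\<lambda>v u. \<Phi> u v) (\<lambda>v u. \<Psi> u v) v u"
proof (induction u arbitrary: \<Phi> \<Psi>)
  case Nil
  have "conv2 (\<lambda>v u. \<Phi> u v) (\<lambda>v u. \<Psi> u v) v [] = conv_word (\<Phi> []) (\<Psi> []) v" for \<Phi> \<Psi>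
    by (induction v arbitrary: \<Phi> \<Psi>) simp_all
  then show ?case by simp
qed (simp add: conv2_Cons_right)

lemma conv_word_linear:
  "conv_word (\<lambda>w. f w + f' w) g w = conv_word f g w + conv_word f' g w"
  "conv_word (\<lambda>w. f w - f' w) g w = conv_word f g w - conv_word f' g w"
  "conv_word f (\<lambda>w. g w + g' w) w = conv_word f g w + conv_word f g' w"
  "conv_word f (\<lambda>w. g w - g' w) w = conv_word f g w - conv_word f g' w"
  by (induction w arbitrary: f f' g g') (simp_all add: algebra_simps)

lemma conv2_linear:
  "conv2 (\<lambda>u v. \<Phi> u v + \<Phi>' u v) \<Psi> u v = conv2 \<Phi> \<Psi> u v + conv2 \<Phi>' \<Psi> u v"
  "conv2 (\<lambda>u v. \<Phi> u v - \<Phi>' u v) \<Psi> u v = conv2 \<Phi> \<Psi> u v - conv2 \<Phi>' \<Psi> u v"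
  "conv2 \<Phi> (\<lambda>u v. \<Psi> u v + \<Psi>' u v) u v = conv2 \<Phi> \<Psi> u v + conv2 \<Phi> \<Psi>' u v"
  "conv2 \<Phi> (\<lambda>u v. \<Psi> u v - \<Psi>' u v) u v = conv2 \<Phi> \<Psi> u v - conv2 \<Phi> \<Psi>' u v"
  by (induction u arbitrary: \<Phi> \<Phi>' \<Psi> \<Psi>') (simp_all add: conv_word_linear algebra_simps)

definition vanish_L :: "(word \<Rightarrow> rat fls) \<Rightarrow> bool" where
  "vanish_L f \<longleftrightarrow> (\<forall>p\<in>L_minus. ext f p = 0)"

lemma vanish_L_Cons: "vanish_L f \<Longrightarrow> vanish_L (\<lambda>w. f (a # w))"
  unfolding vanish_L_def using L_minus_lmul by (metis ext_lmul)

lemma vanish_L_leibniz: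
  assumes "vanish_L f"
  shows "ext (\<lambda>w. f (Ld # w)) (diamond_word u v) =
    ext f (diamond_word (Ld # u) v) + ext f (diamond_word u (Ld # v))"
proof -
  have "ext f (leibniz_gen u v) = 0"
    using assms L_minus_gen[of 0 u v] by (simp add: vanish_L_def)
  then show ?thesis by (simp add: leibniz_gen_def algebra_simps)
qed

lemma ext_basis_diamond: "ext f (basis u \<diamondop>\<^sub>0 p) = ext (\<lambda>v. ext f (diamond_word u v)) p"
  by (induction p rule: free_induct) simp_all

lemma ext_diamond_basis: "ext f (p \<diamondop>\<^sub>0 basis v) = ext (\<lambda>u. ext f (diamond_word u v)) p"
  by (induction p rule: free_induct) simp_all

text \<open>\<open>\<Delta>\<^sub>0\<close> is multiplicative modulo \<open>\<L>\<^sub>-\<close>.\<close>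

lemma ext_conv_diamond:
  assumes "vanish_L f" "vanish_L g"
  shows "ext (conv_word f g) (diamond_word u v) =
    conv2 (\<lambda>u v. ext f (diamond_word u v)) (\<lambda>u v. ext g (diamond_word u v)) u v"
  using assms
proof (induction u v arbitrary: f g rule: diamond_word.induct)
  case (1 v)
  then show ?case by simp
next
  case (2 a u)
  have "conv_word f g w =
      conv2 (\<lambda>u v. ext f (diamond_word u v)) (\<lambda>u v. ext g (diamond_word u v)) w []" for w
    by (simp add: conv2_flip[of _ _ w])
  then show ?case by simp
next
  case (3 u b v)
  then show ?case by (simp add: vanish_L_Cons)
next
  case (4 u v)
  then show ?case by (simp only: diamond_word.simps(4) ext_lmul conv_word.simps ext_fun_add
      vanish_L_Cons conv2_Cons_right diamond_word_Ly_right)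
next
  case (5 u v)
  let ?D = "\<lambda>f w. f (Ld # w)"
  let ?F = "\<lambda>f u v. ext f (diamond_word u v)"
  note V = 5(3,4) vanish_L_Cons[OF 5(3), of Ld] vanish_L_Cons[OF 5(4), of Ld]
  have "ext (conv_word f g) (diamond_word (Ld # u) (Ld # v)) =
      conv2 (?F (?D f)) (?F g) u (Ld # v) + conv2 (?F f) (?F (?D g)) u (Ld # v)
      - conv2 (?F f) (?F g) u (Ld # Ld # v)"
    by (simp add: 5(1)[OF V(3) V(2)] 5(1)[OF V(1) V(4)] 5(2)[OF V(1) V(2)])
  also have "\<dots> = conv2 (?F f) (?F g) (Ld # u) (Ld # v)"
    unfolding conv2.simps conv2_Cons_right vanish_L_leibniz[OF V(1)] vanish_L_leibniz[OF V(2)]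
      conv2_linear
    by (simp del: diamond_word.simps)
  finally show ?case .
qed

lemma ext_conv2_eq_0:
  assumes "\<And>f g. vanish_L f \<Longrightarrow> vanish_L g \<Longrightarrow> ext (conv_word f g) p = 0"
    and "\<And>u. vanish_L (\<Phi> u)" "\<And>u. vanish_L (\<Psi> u)"
  shows "ext (conv2 \<Phi> \<Psi> u) p = 0"
  using assms(2,3)
proof (induction u arbitrary: \<Phi> \<Psi>)
  case Nil
  have "conv2 \<Phi> \<Psi> [] = conv_word (\<Phi> []) (\<Psi> [])" by (rule ext) simp
  then show ?case using assms(1) Nil by simp
next
  case (Cons a u)
  have "conv2 \<Phi> \<Psi> (a # u) =
      (\<lambda>v. conv2 (\<lambda>u. \<Phi> (a # u)) \<Psi> u v + conv2 \<Phi> (\<lambda>u. \<Psi> (a # u)) u v)"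
    by (rule ext) simp
  then show ?case using Cons by simp
qed

lemma ext_conv_L_minus:
  assumes "p \<in> L_minus" "vanish_L f" "vanish_L g"
  shows "ext (conv_word f g) p = 0"
  using assms
proof (induction arbitrary: f g rule: L_minus_induct)
  case (gen k u v)
  then show ?case
  proof (induction k arbitrary: f g)
    case 0
    then show ?case
      by (simp add: leibniz_gen_def ext_conv_diamond vanish_L_Cons vanish_L_leibniz
          conv2_linear conv2_Cons_right)
  next
    case (Suc k)
    then show ?case by (simp add: vanish_L_Cons)
  qed
next
  case (left p q)
  have *: "vanish_L (\<lambda>v. ext f (diamond_word u v))" if "vanish_L f" for f u
    using that L_minus_diamond(1) by (simp add: vanish_L_def flip: ext_basis_diamond)
  have "ext (conv_word f g) (basis u \<diamondop>\<^sub>0 p) = 0" for u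
    using left by (simp add: ext_basis_diamond ext_conv_diamond ext_conv2_eq_0 *)
  then show ?case by (induction q rule: free_induct) simp_all
next
  case (right p q)
  have *: "vanish_L (\<lambda>u. ext f (diamond_word u v))" if "vanish_L f" for f v
    using that L_minus_diamond(2) by (simp add: vanish_L_def flip: ext_diamond_basis)
  have "ext (conv_word f g) (p \<diamondop>\<^sub>0 basis v) = 0" for v
    using right
    by (simp add: ext_diamond_basis ext_conv_diamond conv2_flip[of _ _ _ v] ext_conv2_eq_0 *)
  then show ?case by (induction q rule: free_induct) simp_all
qed simp_all

lemma conv_word_append:
  "conv_word f g (w @ [a]) =
     conv_word (\<lambda>u. f (u @ [a])) g w + conv_word f (\<lambda>u. g (u @ [a])) w"
  by (induction w arbitrary: f g) (simp_all add: algebra_simps)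

lemma conv_word_0: "conv_word (\<lambda>_. 0) g w = 0" "conv_word f (\<lambda>_. 0) w = 0"
  by (induction w arbitrary: f g) simp_all

lemma abs_h0_simps:
  "abs_h0 (p + q) = abs_h0 p + abs_h0 q" "abs_h0 (scale_free c p) = scale_h0 c (abs_h0 p)"
  "abs_h0 0 = 0"
  by (simp_all add: plus_h0.abs_eq scale_h0.abs_eq zero_h0_def)

lemma ext_h0_word:
  assumes "Vector_Spaces.linear scale_h0 scale_fls f"
  shows "ext (\<lambda>w. f (h0_word w)) p = f (abs_h0 p)"
proof -
  interpret f: Vector_Spaces.linear scale_h0 scale_fls f by fact
  show ?thesis
    by (induction p rule: free_induct) (simp_all add: abs_h0_simps h0_word_def f.add f.scale f.zero)
qed

lemma abs_h0_LT_minus: "p \<in> LT_minus \<Longrightarrow> abs_h0 p = 0"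
  unfolding zero_h0_def by (subst h0.abs_eq_iff) (simp add: h0_rel_def)

lemma star_abs_h0:
  assumes f: "Vector_Spaces.linear scale_h0 scale_fls f"
    and g: "Vector_Spaces.linear scale_h0 scale_fls g"
  shows "(f \<star> g) (abs_h0 p) = ext (\<lambda>(u, v). f (h0_word u) * g (h0_word v)) (coprod p)"
proof -
  have V: "vanish_L (\<lambda>w. h (h0_word w))" "h (h0_word (w @ [Ld])) = 0"
    if h: "Vector_Spaces.linear scale_h0 scale_fls h" for h w
  proof -
    interpret h: Vector_Spaces.linear scale_h0 scale_fls h by fact
    show "vanish_L (\<lambda>w. h (h0_word w))"
      using L_minus_subset by (auto simp: vanish_L_def ext_h0_word[OF h] abs_h0_LT_minus h.zero)
    show "h (h0_word (w @ [Ld])) = 0"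
      using T_minus_basis[of w] T_minus_subset by (auto simp: h0_word_def abs_h0_LT_minus h.zero)
  qed
  let ?c = "conv_word (\<lambda>w. f (h0_word w)) (\<lambda>w. g (h0_word w))"
  have "ext ?c r = 0" if "r \<in> LT_minus" for r
    using that
    by (rule lin_ext_LT_minus[OF fls.vector_space_axioms, rotated 2])
      (simp_all add: ext_conv_L_minus V f g conv_word_append conv_word_0)
  moreover have "h0_rel (rep_h0 (abs_h0 p)) p"
    using Quotient3_rep_abs[OF Quotient3_h0 h0_rel_refl] .
  ultimately have "ext ?c (rep_h0 (abs_h0 p)) = ext ?c p"
    by (intro lin_ext_h0_rel fls.vector_space_axioms)
  then show ?thesis
    unfolding star_def ext_coprod[of "\<lambda>w. f (h0_word w)" "\<lambda>w. g (h0_word w)"] .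
qed

lemma conv_word_cong_le:
  "(\<And>u. length u \<le> length w \<Longrightarrow> f u = f' u) \<Longrightarrow> conv_word f g w = conv_word f' g w"
proof (induction w arbitrary: f f' g)
  case (Cons a w)
  have "conv_word (\<lambda>u. f (a # u)) g w = conv_word (\<lambda>u. f' (a # u)) g w"
    by (rule Cons.IH) (simp add: Cons.prems)
  moreover have "conv_word f (\<lambda>u. g (a # u)) w = conv_word f' (\<lambda>u. g (a # u)) w"
    by (rule Cons.IH) (simp add: Cons.prems)
  ultimately show ?case by simp
qed simp

lemma conv_word_cong_less:
  "g [] = 0 \<Longrightarrow> (\<And>u. length u < length w \<Longrightarrow> f u = f' u) \<Longrightarrow> conv_word f g w = conv_word f' g w"
proof (induction w arbitrary: f f')
  case (Cons a w)
  have "conv_word (\<lambda>u. f (a # u)) g w = conv_word (\<lambda>u. f' (a # u)) g w"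
    by (rule Cons.IH) (simp_all add: Cons.prems)
  moreover have "conv_word f (\<lambda>u. g (a # u)) w = conv_word f' (\<lambda>u. g (a # u)) w"
    by (rule conv_word_cong_le) (simp add: Cons.prems)
  ultimately show ?case by simp
qed simp

lemma conv2_cong_le:
  "(\<And>u' v'. length u' + length v' \<le> length u + length v \<Longrightarrow> \<Phi> u' v' = \<Phi>' u' v') \<Longrightarrow>
     conv2 \<Phi> \<Psi> u v = conv2 \<Phi>' \<Psi> u v"
proof (induction u arbitrary: \<Phi> \<Phi>' \<Psi>)
  case Nil
  then show ?case by (auto intro: conv_word_cong_le)
next
  case (Cons a u)
  have "conv2 (\<lambda>u. \<Phi> (a # u)) \<Psi> u v = conv2 (\<lambda>u. \<Phi>' (a # u)) \<Psi> u v"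
    by (rule Cons.IH) (simp add: Cons.prems)
  moreover have "conv2 \<Phi> (\<lambda>u. \<Psi> (a # u)) u v = conv2 \<Phi>' (\<lambda>u. \<Psi> (a # u)) u v"
    by (rule Cons.IH) (simp add: Cons.prems)
  ultimately show ?case by simp
qed

lemma conv2_cong_less:
  "\<Psi> [] [] = 0 \<Longrightarrow>
   (\<And>u' v'. length u' + length v' < length u + length v \<Longrightarrow> \<Phi> u' v' = \<Phi>' u' v') \<Longrightarrow>
     conv2 \<Phi> \<Psi> u v = conv2 \<Phi>' \<Psi> u v"
proof (induction u arbitrary: \<Phi> \<Phi>')
  case Nil
  then show ?case by (auto intro: conv_word_cong_less)
next
  case (Cons a u)
  have "conv2 (\<lambda>u. \<Phi> (a # u)) \<Psi> u v = conv2 (\<lambda>u. \<Phi>' (a # u)) \<Psi> u v"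
    by (rule Cons.IH) (simp_all add: Cons.prems)
  moreover have "conv2 \<Phi> (\<lambda>u. \<Psi> (a # u)) u v = conv2 \<Phi>' (\<lambda>u. \<Psi> (a # u)) u v"
    by (rule conv2_cong_le) (simp add: Cons.prems)
  ultimately show ?case by simp
qed

lemma conv_word_scale:
  "conv_word (\<lambda>w. c * f w) g w = c * conv_word f g w"
  "conv_word f (\<lambda>w. c * g w) w = c * conv_word f g w"
  by (induction w arbitrary: f g) (simp_all add: algebra_simps)

lemma conv2_prod:
  "conv2 (\<lambda>u v. f u * f' v) (\<lambda>u v. g u * g' v) u v = conv_word f g u * conv_word f' g' v"
proof (induction u arbitrary: f g)
  case Nil
  show ?case by (simp add: conv_word_scale)
qed (simp add: distrib_right)

lemma conv_word_commute: "conv_word f g w = conv_word g f w"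
  by (induction w arbitrary: f g) (simp_all add: algebra_simps)

lemma conv_word_assoc: "conv_word f (conv_word g h) w = conv_word (conv_word f g) h w"
  by (induction w arbitrary: f g h) (simp_all add: conv_word_linear algebra_simps)

definition unit_word :: "word \<Rightarrow> rat fls" where
  "unit_word w = (if w = [] then 1 else 0)"

lemma unit_word_simps [simp]: "unit_word [] = 1" "unit_word (a # w) = 0" "unit_word (w @ [a]) = 0"
  by (simp_all add: unit_word_def)

lemma conv_word_unit: "conv_word f unit_word w = f w" "conv_word unit_word f w = f w"
proof -
  show "conv_word f unit_word w = f w"
    by (induction w arbitrary: f) (simp_all add: conv_word_0)
  then show "conv_word unit_word f w = f w"
    by (simp add: conv_word_commute)
qed

lemma ext_unit_word: "ext unit_word p = fls_const (Poly_Mapping.lookup p [])"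
proof (induction p rule: free_induct)
  case (basis w)
  have "ext unit_word (basis w) = unit_word w" by (rule ext_simps(4))
  moreover have "Poly_Mapping.lookup (basis w) [] = (if w = [] then 1 else 0)"
    by (simp add: basis_def lookup_single when_def)
  ultimately show ?case by (simp only: unit_word_def) simp
next
  case (scale c p)
  then have "ext unit_word (scale_free c p) = scale_fls c (fls_const (Poly_Mapping.lookup p []))"
    by (simp only: ext_simps(3))
  also have "\<dots> = fls_const (Poly_Mapping.lookup (scale_free c p) [])"
    by (simp add: scale_fls_def)
  finally show ?case .
qed (simp_all add: lookup_add flip: fls_plus_const)

lemma vanish_L_unit: "vanish_L unit_word"
  by (simp add: vanish_L_def ext_unit_word lookup_L_minus_Nil)

lemma vanish_L_phi: "vanish_L phi_word"
  using phi_free_L_minus by (simp add: vanish_L_def phi_free_def)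

lemma ext_fun_diff: "ext (\<lambda>w. F w - G w) p = ext F p - ext G p"
  by (induction p rule: free_induct) (simp_all add: fls.scale_right_diff_distrib)

lemma vanish_L_diff: "vanish_L f \<Longrightarrow> vanish_L g \<Longrightarrow> vanish_L (\<lambda>w. f w - g w)"
  by (simp add: vanish_L_def ext_fun_diff)

lemma vanish_L_conv: "vanish_L f \<Longrightarrow> vanish_L g \<Longrightarrow> vanish_L (conv_word f g)"
  by (simp add: vanish_L_def ext_conv_L_minus)

definition trunc :: "nat \<Rightarrow> (word \<Rightarrow> rat fls) \<Rightarrow> word \<Rightarrow> rat fls" where
  "trunc n f w = (if length w < n then f w else 0)"

lemma trunc_Cons [simp]: "trunc n f (a # w) = trunc (n - 1) (\<lambda>w. f (a # w)) w"
  by (auto simp: trunc_def)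

lemma ext_zero_fun [simp]: "ext (\<lambda>_. 0) p = 0"
  by (induction p rule: free_induct) simp_all

lemma ext_trunc_diamond:
  "ext (trunc n f) (diamond_word u v) =
     (if length u + length v < n then ext f (diamond_word u v) else 0)"
proof (induction u v arbitrary: n f rule: diamond_word.induct)
  case (1 v)
  show ?case by (simp add: trunc_def)
next
  case (2 a u)
  have "ext (trunc n f) (basis (a # u)) = trunc n f (a # u)" by (rule ext_simps(4))
  then show ?case by (simp add: trunc_def)
qed auto

lemma vanish_L_trunc:
  assumes "vanish_L f"
  shows "vanish_L (trunc n f)"
proof -
  have "ext (trunc n f) p = 0" if "p \<in> L_minus" "vanish_L f" for f n p
    using that
  proof (induction arbitrary: f n rule: L_minus_induct)
    case (gen k u v)
    then show ?case
    proof (induction k arbitrary: f n)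
      case 0
      have "ext f (leibniz_gen u v) = 0" using 0 L_minus_gen[of 0 u v] by (simp add: vanish_L_def)
      then show ?case
        by (simp add: leibniz_gen_def ext_trunc_diamond del: diamond_word.simps) auto
    next
      case (Suc k)
      then show ?case by (simp add: vanish_L_Cons)
    qed
  next
    case (left p q)
    have "ext (trunc n f) (basis u \<diamondop>\<^sub>0 p) = 0" for u
    proof -
      have "(\<lambda>v. ext (trunc n f) (diamond_word u v)) =
          trunc (n - length u) (\<lambda>v. ext f (diamond_word u v))"
        by (intro HOL.ext) (auto simp: ext_trunc_diamond trunc_def)
      moreover have "vanish_L (\<lambda>v. ext f (diamond_word u v))"
        using left.prems L_minus_diamond(1) by (simp add: vanish_L_def flip: ext_basis_diamond)
      ultimately show ?thesis using left.IH by (simp add: ext_basis_diamond)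
    qed
    then show ?case by (induction q rule: free_induct) simp_all
  next
    case (right p q)
    have "ext (trunc n f) (p \<diamondop>\<^sub>0 basis v) = 0" for v
    proof -
      have "(\<lambda>u. ext (trunc n f) (diamond_word u v)) =
          trunc (n - length v) (\<lambda>u. ext f (diamond_word u v))"
        by (intro HOL.ext) (auto simp: ext_trunc_diamond trunc_def)
      moreover have "vanish_L (\<lambda>u. ext f (diamond_word u v))"
        using right.prems L_minus_diamond(2) by (simp add: vanish_L_def flip: ext_diamond_basis)
      ultimately show ?thesis using right.IH by (simp add: ext_diamond_basis)
    qed
    then show ?case by (induction q rule: free_induct) simp_all
  qed simp_all
  then show ?thesis using assms by (simp add: vanish_L_def)
qed

primrec rec_aux :: "(rat fls \<Rightarrow> rat fls) \<Rightarrow> (word \<Rightarrow> rat fls) \<Rightarrow> nat \<Rightarrow> word \<Rightarrow> rat fls" where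
  "rec_aux P q 0 w = 0"
| "rec_aux P q (Suc n) w =
     (if length w \<le> n then unit_word w - P (conv_word (rec_aux P q n) q w) else 0)"

definition rec_word :: "(rat fls \<Rightarrow> rat fls) \<Rightarrow> (word \<Rightarrow> rat fls) \<Rightarrow> word \<Rightarrow> rat fls" where
  "rec_word P q w = rec_aux P q (Suc (length w)) w"

lemma rec_aux_eq:
  assumes "q [] = 0"
  shows "length w < n \<Longrightarrow> rec_aux P q n w = rec_word P q w"
proof (induction n arbitrary: w rule: less_induct)
  case (less n)
  then obtain m where n: "n = Suc m" "length w \<le> m" by (cases n) auto
  have "conv_word (rec_aux P q m) q w = conv_word (rec_aux P q (length w)) q w"
  proof (rule conv_word_cong_less[where g = q, OF assms])
    fix u :: word assume "length u < length w"
    then show "rec_aux P q m u = rec_aux P q (length w) u"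
      using less.IH[of m u] less.IH[of "length w" u] n less.prems by simp
  qed
  then show ?case using n by (simp add: rec_word_def)
qed

lemma rec_word_eq:
  assumes "q [] = 0"
  shows "rec_word P q w = unit_word w - P (conv_word (rec_word P q) q w)"
proof -
  have "conv_word (rec_aux P q (length w)) q w = conv_word (rec_word P q) q w"
    by (rule conv_word_cong_less[where g = q, OF assms]) (simp add: rec_aux_eq[where q = q, OF assms])
  then show ?thesis by (simp add: rec_word_def)
qed

definition P_linear :: "(rat fls \<Rightarrow> rat fls) \<Rightarrow> bool" where
  "P_linear P \<longleftrightarrow> (\<forall>f g. P (f + g) = P f + P g) \<and> (\<forall>c f. P (scale_fls c f) = scale_fls c (P f))"

lemma P_linear_0: "P_linear P \<Longrightarrow> P 0 = 0"
  by (metis P_linear_def fls.scale_zero_left)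

lemma ext_P: "P_linear P \<Longrightarrow> ext (\<lambda>w. P (f w)) p = P (ext f p)"
  by (induction p rule: free_induct) (simp_all add: P_linear_0, simp_all add: P_linear_def)

lemma vanish_L_P: "P_linear P \<Longrightarrow> vanish_L f \<Longrightarrow> vanish_L (\<lambda>w. P (f w))"
  by (simp add: vanish_L_def ext_P P_linear_0)

lemma vanish_L_rec:
  assumes P: "P_linear P" and q: "q [] = 0" "vanish_L q"
  shows "vanish_L (rec_word P q)"
proof -
  have V: "vanish_L (trunc n (rec_word P q))" for n
  proof (induction n)
    case 0
    have "trunc 0 (rec_word P q) = (\<lambda>_. 0)" by (auto simp: trunc_def)
    then show ?case by (simp add: vanish_L_def)
  next
    case (Suc n)
    let ?G = "\<lambda>w. unit_word w - P (conv_word (trunc n (rec_word P q)) q w)"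
    have "trunc (Suc n) (rec_word P q) = trunc (Suc n) ?G"
    proof
      fix w
      have "length w \<le> n \<Longrightarrow> conv_word (rec_word P q) q w = conv_word (trunc n (rec_word P q)) q w"
        by (rule conv_word_cong_less[where g = q]) (simp_all add: q trunc_def)
      then show "trunc (Suc n) (rec_word P q) w = trunc (Suc n) ?G w"
        using rec_word_eq[of q P w] q by (simp add: trunc_def)
    qed
    then show ?case
      using vanish_L_trunc[OF vanish_L_diff[OF vanish_L_unit
            vanish_L_P[OF P vanish_L_conv[OF Suc q(2)]]]] by simp
  qed
  show ?thesis unfolding vanish_L_def
  proof
    fix p assume p: "p \<in> L_minus"
    define n where "n = Suc (Max (insert 0 (length ` Poly_Mapping.keys p)))"
    have "length w < n" if "w \<in> Poly_Mapping.keys p" for w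
      unfolding n_def less_Suc_eq_le using that by (intro Max_ge) auto
    then have "ext (rec_word P q) p = ext (trunc n (rec_word P q)) p"
      unfolding lin_ext_def by (intro sum.cong) (simp_all add: trunc_def)
    then show "ext (rec_word P q) p = 0" using V[of n] p by (simp add: vanish_L_def)
  qed
qed

lemma rec_word_append_Ld:
  assumes P: "P_linear P" and q: "q [] = 0" "\<And>w. q (w @ [Ld]) = 0"
  shows "rec_word P q (w @ [Ld]) = 0"
proof (induction "length w" arbitrary: w rule: less_induct)
  case less
  have "conv_word (rec_word P q) q (w @ [Ld]) = conv_word (\<lambda>u. rec_word P q (u @ [Ld])) q w"
    by (simp add: conv_word_append q conv_word_0)
  also have "\<dots> = conv_word (\<lambda>_. 0) q w"
    by (rule conv_word_cong_less) (simp_all add: q less)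
  finally show ?case
    using rec_word_eq[of q P "w @ [Ld]"] q P_linear_0[OF P] by (simp add: conv_word_0)
qed

definition h0_compatible :: "(word \<Rightarrow> rat fls) \<Rightarrow> bool" where
  "h0_compatible F \<longleftrightarrow> vanish_L F \<and> (\<forall>w. F (w @ [Ld]) = 0)"

definition descend :: "(word \<Rightarrow> rat fls) \<Rightarrow> h0 \<Rightarrow> rat fls" where
  "descend F x = ext F (rep_h0 x)"

lemma descend_abs:
  assumes "h0_compatible F"
  shows "descend F (abs_h0 p) = ext F p"
proof -
  have "ext F r = 0" if "r \<in> LT_minus" for r
    using that assms unfolding h0_compatible_def vanish_L_def
    by (intro lin_ext_LT_minus[OF fls.vector_space_axioms _ _ that]) simp_all
  moreover have "h0_rel (rep_h0 (abs_h0 p)) p"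
    using Quotient3_rep_abs[OF Quotient3_h0 h0_rel_refl] .
  ultimately show ?thesis
    unfolding descend_def by (intro lin_ext_h0_rel fls.vector_space_axioms)
qed

lemma h0_cases: obtains p where "x = abs_h0 p"
  using Quotient3_abs_rep[OF Quotient3_h0] by metis

lemma descend_word: "h0_compatible F \<Longrightarrow> descend F (h0_word w) = F w"
  by (simp add: h0_word_def descend_abs)

lemma linear_h0I:
  assumes "\<And>x y. f (x + y) = f x + f y" "\<And>c x. f (scale_h0 c x) = scale_fls c (f x)"
  shows "Vector_Spaces.linear scale_h0 scale_fls f"
  using assms h0.vector_space_axioms fls.vector_space_axioms
  by (simp add: Vector_Spaces.linear_iff)

definition pole_part :: "rat fls \<Rightarrow> rat fls" where
  "pole_part f = f - fps_to_fls (fls_regpart f)"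

lemma pole_part_nth: "fls_nth (pole_part f) n = (if n < 0 then fls_nth f n else 0)"
  by (simp add: pole_part_def)

definition character :: "(h0 \<Rightarrow> rat fls) \<Rightarrow> bool" where
  "character f \<longleftrightarrow>
     Vector_Spaces.linear scale_h0 scale_fls f \<and> f 1 = 1 \<and> (\<forall>x y. f (x * y) = f x * f y)"

definition conv_unit :: "h0 \<Rightarrow> rat fls" where
  "conv_unit x = fls_const (counit x)"

definition conv_inverse :: "(h0 \<Rightarrow> rat fls) \<Rightarrow> (h0 \<Rightarrow> rat fls) \<Rightarrow> bool" where
  "conv_inverse f g \<longleftrightarrow> Vector_Spaces.linear scale_h0 scale_fls g \<and>
     f \<star> g = conv_unit \<and> g \<star> f = conv_unit"

definition birkhoff_decomposition :: "(h0 \<Rightarrow> rat fls) \<Rightarrow> (h0 \<Rightarrow> rat fls) \<Rightarrow> bool" where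
  "birkhoff_decomposition phi_m phi_p \<longleftrightarrow>
     character phi_m \<and> (\<forall>x. \<forall>n>0. fls_nth (phi_m x) n = 0) \<and>
     character phi_p \<and> (\<forall>x. \<forall>n<0. fls_nth (phi_p x) n = 0) \<and>
     (\<exists>psi. conv_inverse phi_m psi \<and> phi = psi \<star> phi_p) \<and>
     (\<forall>x. phi_m x = conv_unit x - pole_part ((phi_m \<star> (\<lambda>y. phi y - conv_unit y)) x)) \<and>
     (\<forall>x. phi_p x = conv_unit x +
        ((phi_m \<star> (\<lambda>y. phi y - conv_unit y)) x
          - pole_part ((phi_m \<star> (\<lambda>y. phi y - conv_unit y)) x)))"

lemma scale_fls_nth [simp]: "fls_nth (scale_fls c f) n = c * fls_nth f n"
  by (simp add: scale_fls_def)

lemma scale_fls_mult [simp]: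
  "scale_fls c f * g = scale_fls c (f * g)" "f * scale_fls c g = scale_fls c (f * g)"
  by (simp_all add: scale_fls_def mult.assoc mult.left_commute)

lemma h0_compatible_unit: "h0_compatible unit_word"
  by (simp add: h0_compatible_def vanish_L_unit)

lemma h0_compatible_phi: "h0_compatible phi_word"
  by (simp add: h0_compatible_def vanish_L_phi phi_word_append_Ld)

lemma h0_compatible_diff:
  "h0_compatible F \<Longrightarrow> h0_compatible G \<Longrightarrow> h0_compatible (\<lambda>w. F w - G w)"
  by (simp add: h0_compatible_def vanish_L_diff)

lemma h0_compatible_conv:
  "h0_compatible F \<Longrightarrow> h0_compatible G \<Longrightarrow> h0_compatible (conv_word F G)"
  by (simp add: h0_compatible_def vanish_L_conv conv_word_append conv_word_0)

lemma h0_compatible_rec: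
  "P_linear P \<Longrightarrow> q [] = 0 \<Longrightarrow> h0_compatible q \<Longrightarrow> h0_compatible (rec_word P q)"
  by (simp add: h0_compatible_def vanish_L_rec rec_word_append_Ld)

lemma linear_descend:
  assumes "h0_compatible F"
  shows "Vector_Spaces.linear scale_h0 scale_fls (descend F)"
proof (rule linear_h0I)
  fix x y c
  obtain p q where "x = abs_h0 p" "y = abs_h0 q" by (metis h0_cases)
  then show "descend F (x + y) = descend F x + descend F y"
    "descend F (scale_h0 c x) = scale_fls c (descend F x)"
    by (simp_all add: descend_abs assms flip: abs_h0_simps)
qed

lemma star_descend:
  assumes "h0_compatible F" "h0_compatible G"
  shows "descend F \<star> descend G = descend (conv_word F G)"
proof
  fix x
  obtain p where "x = abs_h0 p" by (rule h0_cases)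
  then show "(descend F \<star> descend G) x = descend (conv_word F G) x"
    using ext_coprod[of "\<lambda>w. descend F (h0_word w)" "\<lambda>w. descend G (h0_word w)" p]
    by (simp add: star_abs_h0 linear_descend assms descend_word descend_abs h0_compatible_conv)
qed

lemma descend_diff: "descend (\<lambda>w. F w - G w) x = descend F x - descend G x"
  by (simp add: descend_def ext_fun_diff)

lemma conv_unit_descend: "conv_unit = descend unit_word"
proof
  fix x
  obtain p where "x = abs_h0 p" by (rule h0_cases)
  then show "conv_unit x = descend unit_word x"
    by (simp add: conv_unit_def counit.abs_eq descend_abs h0_compatible_unit ext_unit_word)
qed

lemma phi_descend: "phi = descend phi_word"
proof
  fix x
  obtain p where "x = abs_h0 p" by (rule h0_cases)
  then show "phi x = descend phi_word x"
    by (simp add: phi.abs_eq phi_free_def descend_abs h0_compatible_phi)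
qed

lemma character_descend:
  assumes F: "h0_compatible F" "F [] = 1" and mult: "\<And>u v. ext F (diamond_word u v) = F u * F v"
  shows "character (descend F)"
  unfolding character_def
proof (intro conjI allI)
  show "descend F 1 = 1"
    using F by (simp add: one_h0_def descend_abs)
  fix x y
  obtain p q where xy: "x = abs_h0 p" "y = abs_h0 q" by (metis h0_cases)
  have "ext F (p \<diamondop>\<^sub>0 q) = ext F p * ext F q"
  proof (induction p rule: free_induct)
    case (basis u)
    show ?case
      by (induction q rule: free_induct) (simp_all add: mult distrib_left)
  qed (simp_all add: distrib_right)
  then show "descend F (x * y) = descend F x * descend F y"
    using F by (simp add: xy times_h0.abs_eq descend_abs)
qed (rule linear_descend[OF F(1)])

lemma P_linear_pole_part: "P_linear pole_part"
  by (auto simp: P_linear_def pole_part_nth intro!: fls_eqI)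

lemma P_linear_id: "P_linear (\<lambda>f. f)"
  by (simp add: P_linear_def)

definition regular_fls :: "rat fls \<Rightarrow> bool" where
  "regular_fls f \<longleftrightarrow> (\<forall>n<0. fls_nth f n = 0)"

definition polar_fls :: "rat fls \<Rightarrow> bool" where
  "polar_fls f \<longleftrightarrow> (\<forall>n\<ge>0. fls_nth f n = 0)"

lemma regular_fls_mult: "regular_fls f \<Longrightarrow> regular_fls g \<Longrightarrow> regular_fls (f * g)"
proof -
  assume fg: "regular_fls f" "regular_fls g"
  have "h = fps_to_fls (fls_regpart h)" if "regular_fls h" for h
    using that by (intro fls_eqI) (simp add: regular_fls_def)
  then have "f * g = fps_to_fls (fls_regpart f * fls_regpart g)"
    using fg by (metis fls_times_fps_to_fls)
  then show ?thesis by (simp add: regular_fls_def)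
qed

lemma polar_fls_mult:
  assumes "polar_fls f" "polar_fls g"
  shows "polar_fls (f * g)"
  unfolding polar_fls_def
proof (intro allI impI)
  fix n :: int assume "n \<ge> 0"
  then have "fls_nth f i * fls_nth g (n - i) = 0" for i
    using assms by (cases "i \<ge> 0") (auto simp: polar_fls_def)
  then show "fls_nth (f * g) n = 0"
    unfolding fls_times_nth(2) by (intro sum.neutral ballI)
qed

lemma regular_ext:
  assumes "\<And>w. regular_fls (F w)"
  shows "regular_fls (ext F p)"
  by (induction p rule: free_induct) (use assms in \<open>simp_all add: regular_fls_def\<close>)

lemma nonpos_ext:
  assumes "\<And>w n. n > 0 \<Longrightarrow> fls_nth (F w) n = 0"
  shows "n > 0 \<Longrightarrow> fls_nth (ext F p) n = 0"
  by (induction p rule: free_induct) (use assms in simp_all)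

definition q_word :: "word \<Rightarrow> rat fls" where
  "q_word w = phi_word w - unit_word w"

definition pm_word :: "word \<Rightarrow> rat fls" where
  "pm_word = rec_word pole_part q_word"

definition pp_word :: "word \<Rightarrow> rat fls" where
  "pp_word = conv_word pm_word phi_word"

lemma q_word_Nil: "q_word [] = 0"
  by (simp add: q_word_def)

lemma descend_q_word: "(\<lambda>y. phi y - conv_unit y) = descend q_word"
proof
  fix y
  have "descend q_word y = descend (\<lambda>w. phi_word w - unit_word w) y"
    by (rule arg_cong[where f = "\<lambda>F. descend F y", OF HOL.ext[OF q_word_def]])
  then show "phi y - conv_unit y = descend q_word y"
    by (simp add: phi_descend conv_unit_descend descend_diff)
qed

lemma h0_compatible_q: "h0_compatible q_word"
  unfolding q_word_def using h0_compatible_diff[OF h0_compatible_phi h0_compatible_unit] .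

lemma h0_compatible_pm: "h0_compatible pm_word"
  unfolding pm_word_def
  by (rule h0_compatible_rec) (auto simp: P_linear_pole_part q_word_Nil h0_compatible_q)

lemma h0_compatible_pp: "h0_compatible pp_word"
  unfolding pp_word_def by (intro h0_compatible_conv h0_compatible_pm h0_compatible_phi)

lemma pm_word_eq: "pm_word w = unit_word w - pole_part (conv_word pm_word q_word w)"
  unfolding pm_word_def by (rule rec_word_eq) (rule q_word_Nil)

lemma conv_q_word: "conv_word f q_word w = conv_word f phi_word w - f w"
proof -
  have "conv_word f q_word w = conv_word f phi_word w - conv_word f unit_word w"
    unfolding q_word_def by (rule conv_word_linear)
  then show ?thesis by (simp add: conv_word_unit)
qed

lemma pp_word_eq:
  "pp_word w = unit_word w +
     (conv_word pm_word q_word w - pole_part (conv_word pm_word q_word w))"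
proof -
  have "pp_word w = conv_word pm_word q_word w + pm_word w"
    by (simp add: pp_word_def conv_q_word)
  also have "\<dots> = conv_word pm_word q_word w +
      (unit_word w - pole_part (conv_word pm_word q_word w))"
    by (rule arg_cong[OF pm_word_eq])
  finally show ?thesis by simp
qed

lemma pm_word_Nil: "pm_word [] = 1"
  using pm_word_eq[of "[]"] by (simp add: q_word_Nil P_linear_0[OF P_linear_pole_part])

lemma polar_pole_part: "polar_fls (pole_part f)"
  by (simp add: polar_fls_def pole_part_nth)

lemma polar_pm_word: "w \<noteq> [] \<Longrightarrow> polar_fls (pm_word w)"
  using pm_word_eq[of w] polar_pole_part[of "conv_word pm_word q_word w"]
  by (simp add: unit_word_def polar_fls_def)

lemma regular_pp_word: "regular_fls (pp_word w)"
  by (subst pp_word_eq) (simp add: regular_fls_def pole_part_nth unit_word_def)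

lemma pm_word_mult: "ext pm_word (diamond_word u v) = pm_word u * pm_word v"
proof (induction "length u + length v" arbitrary: u v rule: less_induct)
  case less
  show ?case
  proof (cases "u = [] \<or> v = []")
    case True
    then show ?thesis by (auto simp: pm_word_Nil)
  next
    case False
    let ?F = "\<lambda>f u v. ext f (diamond_word u v)"
    have "ext (conv_word pm_word q_word) (diamond_word u v) = conv2 (?F pm_word) (?F q_word) u v"
      using h0_compatible_pm h0_compatible_q by (simp add: ext_conv_diamond h0_compatible_def)
    also have "\<dots> = conv2 (\<lambda>u v. pm_word u * pm_word v) (?F q_word) u v"
      by (rule conv2_cong_less) (simp_all add: q_word_Nil less)
    also have "?F q_word = (\<lambda>u v. phi_word u * phi_word v - unit_word u * unit_word v)"
    proof (intro HOL.ext)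
      fix u v
      have "?F q_word u v = ?F phi_word u v - ?F unit_word u v"
        unfolding q_word_def by (rule ext_fun_diff)
      moreover have "?F unit_word u v = unit_word u * unit_word v"
        unfolding ext_unit_word by (simp add: lookup_diamond_word_Nil unit_word_def)
      ultimately show "?F q_word u v = phi_word u * phi_word v - unit_word u * unit_word v"
        using phi_free_diamond_word[of u v] by (simp add: phi_free_def)
    qed
    also have "conv2 (\<lambda>u v. pm_word u * pm_word v)
          (\<lambda>u v. phi_word u * phi_word v - unit_word u * unit_word v) u v =
        pp_word u * pp_word v - pm_word u * pm_word v"
      unfolding conv2_linear conv2_prod conv_word_unit pp_word_def ..
    finally have conv: "ext (conv_word pm_word q_word) (diamond_word u v) =
        pp_word u * pp_word v - pm_word u * pm_word v" .
    have "regular_fls (pp_word u * pp_word v)"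
      by (intro regular_fls_mult regular_pp_word)
    moreover have "polar_fls (pm_word u * pm_word v)"
      using False by (intro polar_fls_mult polar_pm_word) auto
    ultimately have "pole_part (pp_word u * pp_word v - pm_word u * pm_word v) =
        - (pm_word u * pm_word v)"
      by (intro fls_eqI) (simp add: pole_part_nth regular_fls_def polar_fls_def)
    moreover have "ext pm_word (diamond_word u v) =
        ext unit_word (diamond_word u v) -
        pole_part (ext (conv_word pm_word q_word) (diamond_word u v))"
    proof -
      have "ext pm_word p = ext (\<lambda>w. unit_word w - pole_part (conv_word pm_word q_word w)) p" for p
        by (rule arg_cong[where f = "\<lambda>F. ext F p", OF HOL.ext[OF pm_word_eq]])
      then show ?thesis by (simp add: ext_fun_diff ext_P[OF P_linear_pole_part])
    qed
    moreover have "ext unit_word (diamond_word u v) = 0"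
      unfolding ext_unit_word using False by (simp add: lookup_diamond_word_Nil)
    ultimately show ?thesis by (simp add: conv)
  qed
qed

lemma pp_word_mult: "ext pp_word (diamond_word u v) = pp_word u * pp_word v"
proof -
  let ?F = "\<lambda>f u v. ext f (diamond_word u v)"
  have "ext pp_word (diamond_word u v) = conv2 (?F pm_word) (?F phi_word) u v"
    unfolding pp_word_def using h0_compatible_pm h0_compatible_phi
    by (simp add: ext_conv_diamond h0_compatible_def)
  also have "?F pm_word = (\<lambda>u v. pm_word u * pm_word v)"
    by (intro HOL.ext) (rule pm_word_mult)
  also have "?F phi_word = (\<lambda>u v. phi_word u * phi_word v)"
    using phi_free_diamond_word by (intro HOL.ext) (simp add: phi_free_def)
  finally show ?thesis by (simp add: conv2_prod pp_word_def)
qed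

lemma birkhoff_decomposition_exists:
  "birkhoff_decomposition (descend pm_word) (descend pp_word)"
proof -
  let ?q = "\<lambda>w. pm_word w - unit_word w"
  define psi where "psi = rec_word (\<lambda>f. f) ?q"
  have q: "h0_compatible ?q" "?q [] = 0"
    by (simp_all add: h0_compatible_diff h0_compatible_pm h0_compatible_unit pm_word_Nil)
  have psi: "h0_compatible psi"
    unfolding psi_def using q by (intro h0_compatible_rec P_linear_id)
  have "conv_word psi pm_word w = unit_word w" for w
    using rec_word_eq[of ?q "\<lambda>f. f" w, OF q(2)]
    by (simp add: conv_word_linear conv_word_unit flip: psi_def)
  then have inv: "conv_word psi pm_word = unit_word" by (rule HOL.ext)
  then have inv': "conv_word pm_word psi = unit_word"
    by (simp add: conv_word_commute[of pm_word psi] fun_eq_iff)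
  have "conv_inverse (descend pm_word) (descend psi)"
    by (simp add: conv_inverse_def linear_descend psi star_descend h0_compatible_pm inv inv'
        conv_unit_descend)
  moreover have "phi = descend psi \<star> descend pp_word"
  proof -
    have "conv_word psi pp_word = phi_word"
      by (rule HOL.ext) (simp add: pp_word_def conv_word_assoc inv conv_word_unit)
    then show ?thesis by (simp add: star_descend psi h0_compatible_pp phi_descend)
  qed
  moreover have "character (descend pm_word)"
    by (rule character_descend) (simp_all add: h0_compatible_pm pm_word_Nil pm_word_mult)
  moreover have "character (descend pp_word)"
    by (rule character_descend) (simp_all add: h0_compatible_pp pp_word_mult,
        simp add: pp_word_def pm_word_Nil)
  moreover have "\<forall>n>0. fls_nth (descend pm_word x) n = 0" for x
  proof (intro allI impI)
    fix n :: int assume "n > 0"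
    have "fls_nth (pm_word w) n = 0" if "n > 0" for w n
      using that polar_pm_word[of w] by (cases "w = []") (auto simp: pm_word_Nil polar_fls_def)
    then show "fls_nth (descend pm_word x) n = 0"
      unfolding descend_def using \<open>n > 0\<close> by (rule nonpos_ext)
  qed
  moreover have "\<forall>n<0. fls_nth (descend pp_word x) n = 0" for x
    using regular_ext[of pp_word, OF regular_pp_word]
    by (simp add: descend_def regular_fls_def)
  moreover have "descend pm_word x =
      descend unit_word x - pole_part (descend (conv_word pm_word q_word) x)" for x
  proof -
    have "descend pm_word x =
        descend (\<lambda>w. unit_word w - pole_part (conv_word pm_word q_word w)) x"
      by (rule arg_cong[where f = "\<lambda>F. descend F x", OF HOL.ext[OF pm_word_eq]])
    then show ?thesis
      by (simp add: descend_diff) (simp add: descend_def ext_P[OF P_linear_pole_part])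
  qed
  moreover have "descend pp_word x = descend unit_word x + (descend (conv_word pm_word q_word) x
      - pole_part (descend (conv_word pm_word q_word) x))" for x
  proof -
    have "descend pp_word x = descend (\<lambda>w. unit_word w +
        (conv_word pm_word q_word w - pole_part (conv_word pm_word q_word w))) x"
      by (rule arg_cong[where f = "\<lambda>F. descend F x", OF HOL.ext[OF pp_word_eq]])
    then show ?thesis
      by (simp add: descend_def ext_fun_diff ext_P[OF P_linear_pole_part])
  qed
  ultimately show ?thesis
    unfolding birkhoff_decomposition_def descend_q_word
      star_descend[OF h0_compatible_pm h0_compatible_q]
    unfolding conv_unit_descend
    by (intro conjI exI[of _ "descend psi"]; blast)
qed

lemma linear_eq_descend:
  assumes f: "Vector_Spaces.linear scale_h0 scale_fls f"
  shows "h0_compatible (\<lambda>w. f (h0_word w))" "f = descend (\<lambda>w. f (h0_word w))"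
proof -
  interpret f: Vector_Spaces.linear scale_h0 scale_fls f by fact
  have "vanish_L (\<lambda>w. f (h0_word w))"
    using L_minus_subset by (auto simp: vanish_L_def ext_h0_word[OF f] abs_h0_LT_minus f.zero)
  moreover have "f (h0_word (w @ [Ld])) = 0" for w
    using T_minus_basis[of w] T_minus_subset by (auto simp: h0_word_def abs_h0_LT_minus f.zero)
  ultimately show *: "h0_compatible (\<lambda>w. f (h0_word w))"
    by (simp add: h0_compatible_def)
  show "f = descend (\<lambda>w. f (h0_word w))"
  proof
    fix x
    obtain p where "x = abs_h0 p" by (rule h0_cases)
    then show "f x = descend (\<lambda>w. f (h0_word w)) x"
      by (simp add: descend_abs * ext_h0_word f)
  qed
qed

lemma birkhoff_decomposition_unique:
  assumes "birkhoff_decomposition phi_m phi_p"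
  shows "phi_m = descend pm_word" "phi_p = descend pp_word"
proof -
  note q = descend_q_word
  define F where "F = (\<lambda>w. phi_m (h0_word w))"
  have lin: "Vector_Spaces.linear scale_h0 scale_fls phi_m"
    using assms by (simp add: birkhoff_decomposition_def character_def)
  have F: "h0_compatible F" "phi_m = descend F"
    unfolding F_def using linear_eq_descend[OF lin] by blast+
  have "phi_m x = conv_unit x - pole_part ((phi_m \<star> descend q_word) x)" for x
    by (rule assms[unfolded birkhoff_decomposition_def q, THEN conjunct2, THEN conjunct2,
          THEN conjunct2, THEN conjunct2, THEN conjunct2, THEN conjunct1, THEN spec])
  then have "descend F (h0_word w) = descend unit_word (h0_word w) -
      pole_part (descend (conv_word F q_word) (h0_word w))" for w
    by (simp add: F(2) conv_unit_descend star_descend F(1) h0_compatible_q)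
  then have F_eq: "F w = unit_word w - pole_part (conv_word F q_word w)" for w
    by (simp add: descend_word F(1) h0_compatible_unit h0_compatible_conv h0_compatible_q)
  have "F w = pm_word w" for w
  proof (induction "length w" arbitrary: w rule: less_induct)
    case less
    have "conv_word F q_word w = conv_word pm_word q_word w"
      by (rule conv_word_cong_less) (simp_all add: q_word_Nil less)
    then show ?case using F_eq[of w] pm_word_eq[of w] by simp
  qed
  then have "F = pm_word" by (rule HOL.ext)
  then show m: "phi_m = descend pm_word" using F by simp
  have pp: "phi_p x = conv_unit x + ((phi_m \<star> (\<lambda>y. phi y - conv_unit y)) x
          - pole_part ((phi_m \<star> (\<lambda>y. phi y - conv_unit y)) x))"
    if "birkhoff_decomposition phi_m phi_p" for phi_m phi_p x
    by (rule that[unfolded birkhoff_decomposition_def, THEN conjunct2, THEN conjunct2,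
          THEN conjunct2, THEN conjunct2, THEN conjunct2, THEN conjunct2, THEN spec])
  show "phi_p = descend pp_word"
    by (rule HOL.ext, subst pp[OF assms], subst pp[OF birkhoff_decomposition_exists])
      (simp only: m)
qed

text \<open>The Birkhoff decomposition of \<open>\<phi>\<close>; existence and uniqueness are proved above.\<close>

definition phi_minus :: "h0 \<Rightarrow> rat fls" where
  "phi_minus = fst (THE d. birkhoff_decomposition (fst d) (snd d))"

definition phi_plus :: "h0 \<Rightarrow> rat fls" where
  "phi_plus = snd (THE d. birkhoff_decomposition (fst d) (snd d))"

lemma birkhoff_decomposition_phi: "birkhoff_decomposition phi_minus phi_plus"
proof -
  have "\<exists>!d. birkhoff_decomposition (fst d) (snd d)"
  proof (rule ex1I[of _ "(descend pm_word, descend pp_word)"])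
    show "birkhoff_decomposition (fst (descend pm_word, descend pp_word))
        (snd (descend pm_word, descend pp_word))"
      using birkhoff_decomposition_exists by simp
    fix d assume "birkhoff_decomposition (fst d) (snd d)"
    then show "d = (descend pm_word, descend pp_word)"
      by (intro prod_eqI) (simp_all only: birkhoff_decomposition_unique fst_conv snd_conv)
  qed
  then show ?thesis unfolding phi_minus_def phi_plus_def by (rule theI')
qed

definition zeta_plus :: "nat list \<Rightarrow> rat" where
  "zeta_plus ks = fls_nth (phi_plus (h0_word (dy_word ks))) 0"

text \<open>
  The index \<open>m\<^sub>1 > \<dots> > m\<^sub>n > 0\<close> is the strictly decreasing list \<open>[m\<^sub>1, \<dots>, m\<^sub>n]\<close>, the argument
  \<open>(s\<^sub>1, \<dots>, s\<^sub>n)\<close> the list \<open>[s\<^sub>1, \<dots>, s\<^sub>n]\<close>.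
\<close>

definition mzv_series :: "complex list \<Rightarrow> complex" where
  "mzv_series s =
     (\<Sum>\<^sub>\<infinity>m\<in>{m :: nat list. length m = length s \<and> sorted_wrt (>) m \<and> (\<forall>i\<in>set m. 0 < i)}.
        \<Prod>j<length s. of_nat (m ! j) powr (- (s ! j)))"

definition mzv_region :: "complex list \<Rightarrow> bool" where
  "mzv_region s \<longleftrightarrow> (\<forall>k\<in>{1..length s}. real k < (\<Sum>j<k. Re (s ! j)))"

definition holomorphic2_on :: "(complex \<times> complex \<Rightarrow> complex) \<Rightarrow> (complex \<times> complex) set \<Rightarrow> bool" where
  "holomorphic2_on f U \<longleftrightarrow>
     open U \<and> (\<forall>p\<in>U. \<exists>a b. (f has_derivative (\<lambda>(h, k). a * h + b * k)) (at p))"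

text \<open>
  Locally a quotient of holomorphic functions; as for the library's \<open>meromorphic_on\<close>, values on the
  zero set of the denominator are unconstrained.
\<close>

definition meromorphic2 :: "(complex \<times> complex \<Rightarrow> complex) \<Rightarrow> bool" where
  "meromorphic2 f \<longleftrightarrow>
     (\<forall>p. \<exists>V g h. p \<in> V \<and> holomorphic2_on g V \<and> holomorphic2_on h V \<and>
        (\<forall>W. open W \<and> W \<subseteq> V \<and> W \<noteq> {} \<longrightarrow> (\<exists>q\<in>W. h q \<noteq> 0)) \<and>
        (\<forall>q\<in>V. h q \<noteq> 0 \<longrightarrow> f q = g q / h q))"

definition mzv_sing2 :: "(complex \<times> complex) set" where
  "mzv_sing2 =
     {(s1, s2). s1 = 1 \<or> s1 + s2 = 2 \<or> s1 + s2 = 1 \<or> (\<exists>j::nat. s1 + s2 = - 2 * of_nat j)}"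

text \<open>
  The continuations are total functions; off the known singularities, where they are required to be
  holomorphic, they are determined by the series.
\<close>

definition mzv_continuation1 :: "(complex \<Rightarrow> complex) \<Rightarrow> bool" where
  "mzv_continuation1 Z \<longleftrightarrow>
     Z meromorphic_on UNIV \<and> Z holomorphic_on - {1} \<and>
     (\<forall>s. mzv_region [s] \<longrightarrow> Z s = mzv_series [s])"

definition mzv_continuation2 :: "(complex \<times> complex \<Rightarrow> complex) \<Rightarrow> bool" where
  "mzv_continuation2 Z \<longleftrightarrow>
     meromorphic2 Z \<and> holomorphic2_on Z (- mzv_sing2) \<and>
     (\<forall>s1 s2. mzv_region [s1, s2] \<longrightarrow> Z (s1, s2) = mzv_series [s1, s2])"

end

theory Submission
  imports Defs
begin

text \<open>
  Everything is expressed through the numbers \<open>c\<^sub>k = k! [z\<^sup>k] x(z)\<close>, called \<open>zeta_neg\<close> below.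
  The equation \<open>x (1 - e\<^sup>z) = e\<^sup>z\<close> gives a recurrence that determines them, Faulhaber's formula for
  power sums, and their vanishing at even positive \<open>k\<close>, because \<open>x + 1 / 2\<close> is odd.

  On the algebraic side, in depth one the regular Birkhoff factor of \<open>d\<^sup>k y\<close> is the regular part of
  \<open>\<partial>\<^sup>k x\<close>, so \<open>\<zeta>\<^sub>+(- k) = c\<^sub>k\<close>. In depth two the coproduct produces mixed terms (counterterm of
  \<open>d\<^sup>i y\<close>) times \<open>\<partial>\<^sup>j x\<close> with \<open>i + j = a + b\<close>. The counterterm is a multiple of \<open>z\<^sup>-\<^sup>i\<^sup>-\<^sup>1\<close>, so their
  constant terms are multiples of the coefficient of \<open>x\<close> of index \<open>a + b + 1\<close>, which is zero for odd
  \<open>a + b\<close>. What is left is the constant term of \<open>\<partial>\<^sup>a (x \<partial>\<^sup>b x)\<close>, and the oddness of \<open>x + 1 / 2\<close>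
  reduces it to \<open>- c\<^sub>a\<^sub>+\<^sub>b / 2\<close> for \<open>b > 0\<close> and to \<open>- c\<^sub>a\<^sub>+\<^sub>b\<close> for \<open>b = 0\<close> (lemma
  \<open>zeta_plus_depth_2\<close>).

  On the analytic side, the values of \<open>\<zeta>\<^sub>1\<close> at nonpositive integers come from the telescoping sum of
  \<open>(m + 1)\<^sup>\<alpha> - m\<^sup>\<alpha>\<close>. The binomial expansion of its summands turns it into a relation between
  \<open>\<zeta>\<^sub>1(1 - \<alpha>), \<dots>, \<zeta>\<^sub>1(N - \<alpha>)\<close> whose remainder is holomorphic for \<open>Re \<alpha> < N\<close>. The case \<open>N = 1\<close> gives the
  residue at \<open>1\<close>, and letting \<open>\<alpha>\<close> tend to \<open>n\<close> with \<open>N = n + 1\<close> gives the recurrence of the \<open>c\<^sub>k\<close> again,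
  so \<open>\<zeta>\<^sub>1(- k) = c\<^sub>k\<close> (lemma \<open>zeta_neg_eq_continuation\<close>).

  For \<open>\<zeta>\<^sub>2\<close> it suffices to look at the complex line \<open>s\<^sub>2 = - b\<close>. There the inner sum is a sum of \<open>b\<close>-th
  powers, and Faulhaber's formula turns the double series into a finite combination of the functions
  \<open>\<zeta>\<^sub>1(t - j)\<close> with multiples of \<open>c\<^sub>b\<^sub>-\<^sub>j\<close> as coefficients for \<open>1 \<le> j < b\<close>. The identity theorem in one variable extends this to
  \<open>t = - a\<close> (lemma \<open>mzv_continuation2_slice\<close>), where for odd \<open>a + b\<close> the vanishing of \<open>c\<^sub>k\<close> at even
  positive \<open>k\<close> leaves the same two cases as on the algebraic side.
\<close>

section \<open>The coefficients of \<open>x(z) = e\<^sup>z / (1 - e\<^sup>z)\<close>\<close>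

text \<open>
  The power series \<open>z x(z)\<close>, as \<open>- e\<^sup>z\<close> over the invertible series \<open>(e\<^sup>z - 1) / z\<close>. It is introduced
  because parity arguments substitute \<open>- z\<close> for \<open>z\<close>, and composition is an operation on power series, not on Laurent series.
\<close>

definition x_num :: "rat fps" where
  "x_num = - (fps_exp 1 * inverse (fps_shift 1 (fps_exp 1 - 1)))"

text \<open>
  With the Bernoulli numbers normalised by \<open>B\<^sub>1 = 1 / 2\<close> this is \<open>- B\<^sub>k\<^sub>+\<^sub>1 / (k + 1)\<close>; it turns
  out to be the value at \<open>- k\<close> of both \<open>\<zeta>\<^sub>+\<close> and \<open>\<zeta>\<^sub>1\<close>.
\<close>

definition zeta_neg :: "nat \<Rightarrow> rat" where
  "zeta_neg k = fact k * fls_nth x_fls (int k)"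

lemma x_num_eq: "(1 - fps_exp 1) * x_num = fps_X * fps_exp 1"
proof -
  let ?s = "fps_shift 1 (fps_exp 1 - 1 :: rat fps)"
  have s: "fps_exp 1 - 1 = fps_X * ?s"
    by (rule fps_ext) simp
  have "(fps_exp 1 - 1) * (fps_exp 1 * inverse ?s) = fps_X * ?s * (fps_exp 1 * inverse ?s)"
    by (simp only: s[symmetric])
  also have "\<dots> = fps_X * fps_exp 1 * (?s * inverse ?s)"
    by (simp only: mult.assoc mult.left_commute)
  also have "?s * inverse ?s = 1"
    by (subst mult.commute, rule inverse_mult_eq_1) simp
  finally have "(fps_exp 1 - 1) * (fps_exp 1 * inverse ?s) = fps_X * fps_exp 1" by simp
  moreover have "(1 - fps_exp 1) * x_num = (fps_exp 1 - 1) * (fps_exp 1 * inverse ?s)"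
    unfolding x_num_def by algebra
  ultimately show ?thesis by (simp only:)
qed

lemma one_minus_fps_exp_nonzero: "(1 - fps_exp 1 :: rat fps) \<noteq> 0"
proof
  assume "(1 - fps_exp 1 :: rat fps) = 0"
  then have "fps_nth (1 - fps_exp 1 :: rat fps) 1 = 0" by simp
  then show False by simp
qed

lemma x_fls_nth: "fls_nth x_fls n = (if n < - 1 then 0 else fps_nth x_num (nat (n + 1)))"
proof -
  let ?e = "fps_to_fls (1 - fps_exp 1 :: rat fps)"
  have e: "?e \<noteq> 0"
    by (simp only: fps_to_fls_eq_0_iff one_minus_fps_exp_nonzero) simp
  have "x_fls * ?e = fps_to_fls (fps_exp 1)"
    using e by (simp add: x_fls_def)
  then have "fls_X * (x_fls * ?e) = fps_to_fls (fps_X * fps_exp 1)"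
    unfolding fls_times_fps_to_fls fps_X_to_fls by (simp only:)
  then have "?e * (fls_X * x_fls) = fps_to_fls (fps_X * fps_exp 1)"
    by (simp only: mult.assoc mult.left_commute mult.commute)
  also have "\<dots> = ?e * fps_to_fls x_num"
    by (simp add: fls_times_fps_to_fls flip: x_num_eq)
  finally have "fls_X * x_fls = fps_to_fls x_num"
    using e by simp
  then have "fls_nth (fls_X * x_fls) (n + 1) = fls_nth (fps_to_fls x_num) (n + 1)" by simp
  then show ?thesis by (simp add: fls_X_times_conv_shift)
qed

lemma x_num_nth_0: "fps_nth x_num 0 = - 1"
proof -
  have "fps_nth ((1 - fps_exp 1) * x_num) 1 = fps_nth (fps_X * fps_exp 1) 1"
    by (simp only: x_num_eq)
  then show ?thesis by (simp add: fps_mult_nth)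
qed

lemma x_num_nth_Suc: "fps_nth x_num (Suc n) = zeta_neg n / fact n"
  by (simp add: zeta_neg_def x_fls_nth nat_add_distrib)

text \<open>
  This is the coefficient of \<open>z\<^sup>n\<close> in \<open>x (e\<^sup>z - 1) = - e\<^sup>z\<close>, multiplied by \<open>n!\<close>; the term
  \<open>1 / (n + 1)\<close> comes from the pole \<open>- 1 / z\<close> of \<open>x\<close>. Taken at \<open>n = k + 1\<close> it expresses the value of
  index \<open>k\<close> by those of smaller index, so it characterises the sequence: that is how the analytic
  zeta values will be identified.
\<close>

lemma zeta_neg_recurrence:
  "(\<Sum>j=1..n. of_nat (n choose j) * zeta_neg (n - j)) = 1 / of_nat (n + 1) - 1"
proof -
  have "fps_nth ((1 - fps_exp 1) * x_num) (Suc n) = fps_nth (fps_X * fps_exp 1) (Suc n)"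
    by (simp only: x_num_eq)
  moreover have "fps_nth (fps_X * fps_exp 1) (Suc n) = (1 / fact n :: rat)" by simp
  ultimately have "(\<Sum>i=0..Suc n. fps_nth (1 - fps_exp 1) i * fps_nth x_num (Suc n - i)) = 1 / fact n"
    by (simp only: fps_mult_nth)
  also have "{0..Suc n} = insert 0 (insert (Suc n) {1..n})" by auto
  also have "(\<Sum>i\<in>\<dots>. fps_nth (1 - fps_exp 1) i * fps_nth x_num (Suc n - i)) =
      1 / fact (Suc n) - (\<Sum>j=1..n. 1 / fact j * fps_nth x_num (Suc n - j))"
    by (simp add: x_num_nth_0 sum_negf[symmetric] del: fact_Suc)
  finally have "(\<Sum>j=1..n. 1 / fact j * fps_nth x_num (Suc n - j)) = 1 / fact (Suc n) - 1 / fact n"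
    by simp
  then have "fact n * (\<Sum>j=1..n. 1 / fact j * fps_nth x_num (Suc n - j)) =
      fact n * (1 / fact (Suc n) - 1 / fact n)" by simp
  moreover have "fact n * (\<Sum>j=1..n. 1 / fact j * fps_nth x_num (Suc n - j)) =
      (\<Sum>j=1..n. of_nat (n choose j) * zeta_neg (n - j))"
    unfolding sum_distrib_left
  proof (rule sum.cong[OF refl])
    fix j assume "j \<in> {1..n}"
    then have j: "j \<le> n" by simp
    show "fact n * (1 / fact j * fps_nth x_num (Suc n - j)) = of_nat (n choose j) * zeta_neg (n - j)"
      using j by (simp add: Suc_diff_le x_num_nth_Suc binomial_fact)
  qed
  moreover have "fact n * (1 / fact (Suc n) - 1 / fact n) = 1 / of_nat (n + 1) - (1 :: rat)"
    by (simp add: right_diff_distrib)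
  ultimately show ?thesis by simp
qed

lemma zeta_neg_0: "zeta_neg 0 = - (1 / 2)"
  using zeta_neg_recurrence[of 1] by simp

text \<open>
  The symmetry \<open>x(- z) = - x(z) - 1\<close>: up to its constant term, \<open>x\<close> is odd. These are the trivial
  zeros of \<open>\<zeta>\<close>.
\<close>

lemma zeta_neg_even_eq_0:
  assumes "even n" "n \<noteq> 0"
  shows "zeta_neg n = 0"
proof -
  let ?r = "fps_compose x_num (- fps_X)"
  have "fps_compose ((1 - fps_exp 1) * x_num) (- fps_X) =
      (1 - fps_exp (- 1)) * ?r"
    by (simp add: fps_compose_mult_distrib fps_compose_sub_distrib)
  moreover have "fps_compose (fps_X * fps_exp 1) (- fps_X) = - (fps_X * fps_exp (- 1 :: rat))"
    by (simp add: fps_compose_mult_distrib)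
  ultimately have "(1 - fps_exp (- 1)) * ?r = - (fps_X * fps_exp (- 1 :: rat))"
    by (simp only: x_num_eq)
  \<comment> \<open>Multiplying by \<open>e\<^sup>z\<close> turns \<open>1 - e\<^sup>-\<^sup>z\<close> back into \<open>e\<^sup>z - 1\<close>, the denominator for \<open>x_num\<close>.\<close>
  then have "fps_exp 1 * ((1 - fps_exp (- 1)) * ?r) = fps_exp 1 * - (fps_X * fps_exp (- 1 :: rat))"
    by simp
  moreover have "fps_exp 1 * fps_exp (- 1 :: rat) = 1"
    using fps_exp_add_mult[of "1 :: rat" "- 1"] by simp
  ultimately have "(1 - fps_exp 1) * ?r = fps_X"
    by algebra
  then have "(1 - fps_exp 1) * (x_num - ?r) = (1 - fps_exp 1) * - fps_X"
    using x_num_eq by (simp add: algebra_simps)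
  then have "x_num - ?r = - fps_X"
    using one_minus_fps_exp_nonzero by (simp only: mult_cancel_left) simp
  then have "fps_nth (x_num - ?r) (Suc n) = fps_nth (- fps_X) (Suc n)" by simp
  then have "fps_nth x_num (Suc n) = 0"
    using assms by (simp add: fps_compose_uminus')
  then show ?thesis by (simp add: x_num_nth_Suc)
qed

text \<open>
  Faulhaber's formula. The generating function of the left-hand side is
  \<open>e\<^sup>z + \<dots> + e\<^sup>m\<^sup>z = e\<^sup>z (e\<^sup>m\<^sup>z - 1) / (e\<^sup>z - 1) = - x(z) (e\<^sup>m\<^sup>z - 1)\<close>, so the coefficients of \<open>x\<close> appear
  directly and Bernoulli numbers are never mentioned.
\<close>

lemma sum_powers:
  "(\<Sum>n=1..m. (of_nat n :: rat) ^ b) = of_nat m ^ (b + 1) / of_nat (b + 1) -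
     (\<Sum>j=1..b. of_nat (b choose j) * zeta_neg (b - j) * of_nat m ^ j)"
proof -
  have "(fps_exp 1 - 1) * (\<Sum>n=1..m. fps_exp (of_nat n)) =
      fps_exp 1 * (fps_exp (of_nat m) - 1 :: rat fps)"
  proof (induction m)
    case (Suc m)
    have "fps_exp (1 + of_nat m :: rat) = fps_exp 1 * fps_exp (of_nat m)"
      by (rule fps_exp_add_mult)
    then show ?case using Suc by (simp add: algebra_simps)
  qed simp
  then have "(1 - fps_exp 1) * (fps_X * (\<Sum>n=1..m. fps_exp (of_nat n))) =
      - (fps_X * fps_exp 1) * (fps_exp (of_nat m) - 1 :: rat fps)"
    by algebra
  also have "\<dots> = (1 - fps_exp 1) * (- (x_num * (fps_exp (of_nat m) - 1)))"
    unfolding x_num_eq[symmetric] by algebra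
  finally have "fps_X * (\<Sum>n=1..m. fps_exp (of_nat n)) = - (x_num * (fps_exp (of_nat m) - 1))"
    using one_minus_fps_exp_nonzero by (simp only: mult_cancel_left) simp
  then have "fps_nth (fps_X * (\<Sum>n=1..m. fps_exp (of_nat n))) (Suc b) =
      fps_nth (- ((fps_exp (of_nat m) - 1) * x_num)) (Suc b)" by (simp only: mult.commute)
  moreover have "fps_nth (fps_X * (\<Sum>n=1..m. fps_exp (of_nat n))) (Suc b) =
      (\<Sum>n=1..m. of_nat n ^ b / fact b :: rat)"
    by (simp add: fps_sum_nth del: sum.cl_ivl_Suc)
  ultimately have "(\<Sum>n=1..m. of_nat n ^ b / fact b) =
      - (\<Sum>i=0..Suc b. fps_nth (fps_exp (of_nat m) - 1) i * fps_nth x_num (Suc b - i))"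
    by (simp only: fps_mult_nth fps_neg_nth)
  also have "{0..Suc b} = insert 0 (insert (Suc b) {1..b})" by auto
  also have "- (\<Sum>i\<in>\<dots>. fps_nth (fps_exp (of_nat m) - 1) i * fps_nth x_num (Suc b - i)) =
      of_nat m ^ Suc b / fact (Suc b) - (\<Sum>j=1..b. of_nat m ^ j / fact j * fps_nth x_num (Suc b - j))"
    by (simp add: x_num_nth_0 sum_negf[symmetric] del: fact_Suc power_Suc)
  finally have "fact b * (\<Sum>n=1..m. of_nat n ^ b / fact b) = fact b * (of_nat m ^ Suc b / fact (Suc b) -
      (\<Sum>j=1..b. of_nat m ^ j / fact j * fps_nth x_num (Suc b - j)))" by simp
  also have "\<dots> = of_nat m ^ (b + 1) / of_nat (b + 1) -
      (\<Sum>j=1..b. fact b * (of_nat m ^ j / fact j * fps_nth x_num (Suc b - j)))"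
    by (simp add: right_diff_distrib sum_distrib_left)
  also have "(\<Sum>j=1..b. fact b * (of_nat m ^ j / fact j * fps_nth x_num (Suc b - j))) =
      (\<Sum>j=1..b. of_nat (b choose j) * zeta_neg (b - j) * of_nat m ^ j)"
    by (rule sum.cong[OF refl]) (simp add: Suc_diff_le x_num_nth_Suc binomial_fact)
  finally show ?thesis by (simp add: sum_distrib_left)
qed

section \<open>Birkhoff factors in depth at most two\<close>

lemma fls_deriv_power_nth:
  fixes f :: "rat fls"
  shows "fls_nth ((fls_deriv ^^ k) f) n = pochhammer (of_int (n + 1)) k * fls_nth f (n + int k)"
proof (induction k arbitrary: n)
  case (Suc k)
  have "fls_nth ((fls_deriv ^^ Suc k) f) n = of_int (n + 1) * fls_nth ((fls_deriv ^^ k) f) (n + 1)"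
    by simp
  also have "\<dots> = pochhammer (of_int (n + 1)) (Suc k) * fls_nth f (n + int (Suc k))"
    unfolding Suc by (simp add: pochhammer_rec algebra_simps)
  finally show ?case .
qed simp

lemma constant_term_deriv_power:
  fixes f :: "rat fls"
  shows "fls_nth ((fls_deriv ^^ k) f) 0 = fact k * fls_nth f (int k)"
  unfolding fls_deriv_power_nth by (simp add: pochhammer_fact)

lemma phi_word_replicate: "phi_word (replicate k Ld @ w) = (fls_deriv ^^ k) (phi_word w)"
  by (induction k) simp_all

text \<open>
  The uniqueness of the Birkhoff decomposition replaces the abstract regular factor by its recursive
  description on words.
\<close>

lemma zeta_plus_eq: "zeta_plus ks = fls_nth (pp_word (dy_word ks)) 0"
  unfolding zeta_plus_def birkhoff_decomposition_unique(2)[OF birkhoff_decomposition_phi]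
  by (simp add: descend_word h0_compatible_pp)

text \<open>
  Letters \<open>d\<close> at the end of a word cannot be passed to a factor that kills words ending in \<open>d\<close>.
\<close>

lemma conv_word_append_replicate:
  assumes "\<And>u. G (u @ [Ld]) = 0"
  shows "conv_word F G (w @ replicate b Ld) = conv_word (\<lambda>u. F (u @ replicate b Ld)) G w"
proof (induction b arbitrary: F)
  case (Suc b)
  have "conv_word F G (w @ replicate (Suc b) Ld) = conv_word F G ((w @ replicate b Ld) @ [Ld])"
    by (simp add: replicate_append_same)
  also have "\<dots> = conv_word (\<lambda>u. F (u @ [Ld])) G (w @ replicate b Ld)"
    unfolding conv_word_append[of F G "w @ replicate b Ld"] by (simp add: assms conv_word_0)
  finally show ?case unfolding Suc by (simp add: replicate_append_same)
qed simp

text \<open>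
  The letter \<open>d\<close> is primitive, so convolution satisfies the iterated Leibniz rule on its powers.
\<close>

lemma conv_word_replicate:
  "conv_word F G (replicate a Ld) =
     (\<Sum>i\<le>a. of_nat (a choose i) * (F (replicate i Ld) * G (replicate (a - i) Ld)))"
proof (induction a arbitrary: F G)
  case (Suc a)
  let ?t = "\<lambda>i j. F (replicate i Ld) * G (replicate j Ld)"
  have "conv_word F G (replicate (Suc a) Ld) =
      (\<Sum>i\<le>a. of_nat (a choose i) * ?t (Suc i) (a - i)) +
      (\<Sum>i\<le>a. of_nat (a choose i) * ?t i (Suc a - i))"
    by (simp add: Suc Suc_diff_le)
  also have "(\<Sum>i\<le>a. of_nat (a choose i) * ?t i (Suc a - i)) =
      (\<Sum>i\<le>Suc a. of_nat (a choose i) * ?t i (Suc a - i))"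
    by simp
  also have "\<dots> = ?t 0 (Suc a) + (\<Sum>i\<le>a. of_nat (a choose Suc i) * ?t (Suc i) (a - i))"
    by (subst sum.atMost_Suc_shift) simp
  also have "(\<Sum>i\<le>a. of_nat (a choose i) * ?t (Suc i) (a - i)) + \<dots> =
      (\<Sum>i\<le>Suc a. of_nat (Suc a choose i) * ?t i (Suc a - i))"
    unfolding sum.atMost_Suc_shift[of "\<lambda>i. of_nat (Suc a choose i) * ?t i (Suc a - i)"]
    by (simp add: sum.distrib[symmetric] algebra_simps)
  finally show ?case .
qed simp

lemma conv_word_depth_1:
  assumes "\<And>u. G (u @ [Ld]) = 0"
  shows "conv_word F G (replicate a Ld @ [Ly]) = F (replicate a Ld @ [Ly]) * G [] +
    (\<Sum>i\<le>a. of_nat (a choose i) * (F (replicate i Ld) * G (replicate (a - i) Ld @ [Ly])))"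
proof -
  have "conv_word (\<lambda>u. F (u @ [Ly])) G ([] @ replicate a Ld) =
      conv_word (\<lambda>u. F ((u @ replicate a Ld) @ [Ly])) G []"
    by (rule conv_word_append_replicate[where G = G, OF assms])
  then show ?thesis
    by (simp add: conv_word_append conv_word_replicate)
qed

lemma conv_word_dy_1:
  assumes "h0_compatible F" "h0_compatible G"
  shows "conv_word F G (dy_word [k]) = F (dy_word [k]) * G [] + F [] * G (dy_word [k])"
proof -
  have F: "F (u @ [Ld]) = 0" and G: "G (u @ [Ld]) = 0" for u
    using assms by (simp_all add: h0_compatible_def)
  have "F (replicate (Suc i) Ld) = 0" for i
    using F[of "replicate i Ld"] by (simp add: replicate_append_same)
  then have "(\<Sum>i\<le>k. of_nat (k choose i) * (F (replicate i Ld) * G (replicate (k - i) Ld @ [Ly]))) =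
      F [] * G (replicate k Ld @ [Ly])"
    by (subst sum.atMost_shift) simp
  then show ?thesis
    by (simp add: dy_word_def conv_word_depth_1 G)
qed

text \<open>
  If the two letters \<open>y\<close> go to different factors, the block \<open>d\<^sup>b\<close> between them must follow the second
  \<open>y\<close>, since otherwise one factor receives a word ending in \<open>d\<close>; only the leading block \<open>d\<^sup>a\<close> is
  distributed freely.
\<close>

lemma conv_word_dy_2:
  assumes "h0_compatible F" "h0_compatible G"
  shows "conv_word F G (dy_word [a, b]) = F (dy_word [a, b]) * G [] + F [] * G (dy_word [a, b]) +
    (\<Sum>i\<le>a. of_nat (a choose i) * (F (dy_word [i + b]) * G (dy_word [a - i]))) +
    (\<Sum>i\<le>a. of_nat (a choose i) * (G (dy_word [i + b]) * F (dy_word [a - i])))"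
proof -
  have half: "conv_word (\<lambda>u. F (u @ [Ly])) G ((replicate a Ld @ [Ly]) @ replicate b Ld) =
      F (dy_word [a, b]) * G [] +
      (\<Sum>i\<le>a. of_nat (a choose i) * (F (dy_word [i + b]) * G (dy_word [a - i])))"
    if "h0_compatible G" for F G
  proof -
    have G: "G (u @ [Ld]) = 0" for u
      using that by (simp add: h0_compatible_def)
    have "conv_word (\<lambda>u. F (u @ [Ly])) G ((replicate a Ld @ [Ly]) @ replicate b Ld) =
        conv_word (\<lambda>u. F ((u @ replicate b Ld) @ [Ly])) G (replicate a Ld @ [Ly])"
      by (rule conv_word_append_replicate[where G = G, OF G])
    then show ?thesis
      by (simp add: conv_word_depth_1 G dy_word_def replicate_add)
  qed
  have "conv_word F G (dy_word [a, b]) =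
      conv_word F G (((replicate a Ld @ [Ly]) @ replicate b Ld) @ [Ly])"
    by (simp add: dy_word_def)
  also have "\<dots> = conv_word (\<lambda>u. F (u @ [Ly])) G ((replicate a Ld @ [Ly]) @ replicate b Ld) +
      conv_word (\<lambda>u. G (u @ [Ly])) F ((replicate a Ld @ [Ly]) @ replicate b Ld)"
    unfolding conv_word_append[of F G "(replicate a Ld @ [Ly]) @ replicate b Ld"]
      conv_word_commute[of F "\<lambda>u. G (u @ [Ly])"] ..
  finally show ?thesis
    unfolding half[OF assms(1)] half[OF assms(2)] by (simp add: algebra_simps)
qed

lemma constant_term_pm_word: "w \<noteq> [] \<Longrightarrow> fls_nth (pm_word w) 0 = 0"
  using polar_pm_word[of w] by (simp add: polar_fls_def)

lemma dy_word_nonempty: "dy_word (k # ks) \<noteq> []"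
  by (simp add: dy_word_def)

lemma pp_word_dy_1: "pp_word (dy_word [k]) = pm_word (dy_word [k]) + phi_word (dy_word [k])"
  unfolding pp_word_def conv_word_dy_1[OF h0_compatible_pm h0_compatible_phi]
  by (simp add: pm_word_Nil)

lemma phi_word_dy_1: "phi_word (dy_word [k]) = (fls_deriv ^^ k) x_fls"
  by (simp add: dy_word_def phi_word_replicate)

lemma zeta_plus_depth_1: "zeta_plus [k] = zeta_neg k"
  unfolding zeta_plus_eq pp_word_dy_1
  by (simp add: constant_term_pm_word dy_word_nonempty phi_word_dy_1 constant_term_deriv_power
      zeta_neg_def)

text \<open>
  In depth one the counterterm cancels the pole of \<open>\<partial>\<^sup>k x\<close>, which is a single monomial because \<open>x\<close>
  has a simple pole.
\<close>

lemma pm_word_dy_1_nth: "fls_nth (pm_word (dy_word [k])) n \<noteq> 0 \<Longrightarrow> n = - int k - 1"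
proof -
  assume nz: "fls_nth (pm_word (dy_word [k])) n \<noteq> 0"
  then have n: "n < 0"
    using polar_pm_word[OF dy_word_nonempty, of k "[]"] not_less unfolding polar_fls_def by blast
  have "fls_nth (pp_word (dy_word [k])) n = 0"
    using regular_pp_word n by (simp add: regular_fls_def)
  then have "fls_nth (pm_word (dy_word [k])) n = - fls_nth ((fls_deriv ^^ k) x_fls) n"
    by (simp add: pp_word_dy_1 phi_word_dy_1 eq_neg_iff_add_eq_0)
  with nz have nz: "pochhammer (of_int (n + 1)) k * fls_nth x_fls (n + int k) \<noteq> (0 :: rat)"
    by (simp add: fls_deriv_power_nth)
  \<comment> \<open>Below degree \<open>- k - 1\<close> the coefficients of \<open>x\<close> vanish; between \<open>- k\<close> and \<open>- 1\<close> the factors from differentiation do.\<close>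
  then have "n + int k \<ge> - 1"
    by (auto simp: x_fls_nth split: if_splits)
  moreover have "\<not> n + int k \<ge> 0"
  proof
    assume "n + int k \<ge> 0"
    then have "nat (- (n + 1)) < k" "n + 1 = - int (nat (- (n + 1)))"
      using n by auto
    then have "pochhammer (of_int (n + 1) :: rat) k = 0"
      unfolding pochhammer_eq_0_iff
      by (intro exI[of _ "nat (- (n + 1))"]) (metis of_int_minus of_int_of_nat_eq)
    with nz show False by simp
  qed
  ultimately show ?thesis by simp
qed

text \<open>
  The monomial \<open>z\<^sup>-\<^sup>i\<^sup>-\<^sup>1\<close> of the counterterm meets the coefficient of \<open>x\<close> of even index
  \<open>i + j + 1 \<ge> 2\<close>, which is zero. Hence odd weight \<open>i + j\<close> makes the subtraction of subdivergences
  invisible in the constant term.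
\<close>

lemma constant_term_pm_times_phi:
  assumes "odd (i + j)"
  shows "fls_nth (pm_word (dy_word [i]) * phi_word (dy_word [j])) 0 = 0"
proof -
  have "fls_nth (pm_word (dy_word [i])) n * fls_nth (phi_word (dy_word [j])) (0 - n) = 0" for n
  proof (cases "n = - int i - 1")
    case True
    have "zeta_neg (i + j + 1) = 0"
      using assms by (intro zeta_neg_even_eq_0) auto
    moreover have "int (i + j + 1) = 0 - n + int j" using True by simp
    ultimately have "fls_nth x_fls (0 - n + int j) = 0"
      by (simp add: zeta_neg_def del: of_nat_add)
    then show ?thesis by (simp only: phi_word_dy_1 fls_deriv_power_nth mult_zero_right)
  next
    case False
    then show ?thesis using pm_word_dy_1_nth[of i n] by auto
  qed
  then show ?thesis
    unfolding fls_times_nth(2) by (intro sum.neutral ballI)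
qed

lemma fls_times_nth_parity:
  fixes f g :: "rat fls"
  assumes "\<And>n. fls_nth f n \<noteq> 0 \<Longrightarrow> odd n" "\<And>n. fls_nth g n \<noteq> 0 \<Longrightarrow> even (n - c)" "even (n - c)"
  shows "fls_nth (f * g) n = 0"
proof -
  have "fls_nth f i * fls_nth g (n - i) = 0" for i
  proof (rule ccontr)
    assume "fls_nth f i * fls_nth g (n - i) \<noteq> 0"
    then have "odd i" "even (n - i - c)" using assms(1)[of i] assms(2)[of "n - i"] by auto
    then show False using assms(3) by presburger
  qed
  then show ?thesis
    unfolding fls_times_nth(2) by (intro sum.neutral ballI)
qed

text \<open>
  For odd \<open>a + b\<close> only the constant term of \<open>\<partial>\<^sup>a (x \<partial>\<^sup>b x)\<close> survives. Writing \<open>x = y - 1 / 2\<close> with \<open>y\<close>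
  odd, the product \<open>y \<partial>\<^sup>b y\<close> has the wrong parity to contribute to degree \<open>a\<close>. What remains is
  \<open>- 1 / 2\<close> times \<open>\<partial>\<^sup>b y\<close>, occurring twice when \<open>b = 0\<close> because then both factors carry the constant.
\<close>

lemma zeta_plus_depth_2:
  assumes "odd (a + b)"
  shows "zeta_plus [a, b] = (if b = 0 then - 1 else - (1 / 2)) * zeta_neg (a + b)"
proof -
  have cross: "(\<Sum>i\<le>a. of_nat (a choose i) *
      fls_nth (pm_word (dy_word [i + b]) * phi_word (dy_word [a - i])) 0) = 0"
    "(\<Sum>i\<le>a. of_nat (a choose i) *
      fls_nth (phi_word (dy_word [i + b]) * pm_word (dy_word [a - i])) 0) = 0"
    by (rule sum.neutral; use assms in \<open>auto simp: constant_term_pm_times_phi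
      mult.commute[of "phi_word _" "pm_word _"] split: nat_diff_split\<close>)+
  have nth: "fls_nth (of_nat c * f) 0 = of_nat c * fls_nth f 0" for c and f :: "rat fls"
    by (simp add: fls_of_nat)
  have "zeta_plus [a, b] = fls_nth (phi_word (dy_word [a, b])) 0"
    unfolding zeta_plus_eq pp_word_def conv_word_dy_2[OF h0_compatible_pm h0_compatible_phi]
    using cross
    by (simp add: constant_term_pm_word dy_word_nonempty pm_word_Nil fls_nth_sum nth)
  also have "phi_word (dy_word [a, b]) = (fls_deriv ^^ a) (x_fls * (fls_deriv ^^ b) x_fls)"
    by (simp add: dy_word_def phi_word_replicate)
  finally have *: "zeta_plus [a, b] = fact a * fls_nth (x_fls * (fls_deriv ^^ b) x_fls) (int a)"
    by (simp add: constant_term_deriv_power)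
  define y where "y = x_fls + fls_const (1 / 2)"
  have x: "x_fls = y - fls_const (1 / 2)" by (simp add: y_def)
  have y_odd: "fls_nth y n \<noteq> 0 \<Longrightarrow> odd n" for n
  proof (rule ccontr)
    assume nz: "fls_nth y n \<noteq> 0" and "\<not> odd n"
    then have n: "even n" by simp
    with nz have "n \<ge> 0" 
      by (cases "n = - 1") (auto simp: y_def x_fls_nth split: if_splits)
    then obtain m where m: "n = int m" using nonneg_int_cases by blast
    show False
    proof (cases "m = 0")
      case True
      then show False using nz m zeta_neg_0 by (simp add: y_def zeta_neg_def)
    next
      case False
      then show False using nz m n zeta_neg_even_eq_0[of m] by (simp add: y_def zeta_neg_def)
    qed
  qed
  have dy: "fls_nth ((fls_deriv ^^ b) y) n \<noteq> 0 \<Longrightarrow> even (n - (int b + 1))" for n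
    using y_odd[of "n + int b"] by (auto simp: fls_deriv_power_nth)
  have yy: "fls_nth (y * (fls_deriv ^^ b) y) (int a) = 0"
    by (rule fls_times_nth_parity[OF y_odd dy]) (use assms in auto)
  show ?thesis
  proof (cases "b = 0")
    case True
    have "x_fls * x_fls = y * y - y + fls_const (1 / 4)"
      unfolding x by (simp add: algebra_simps fls_const_mult_const flip: fls_plus_const)
        (simp add: fls_eq_iff)
    moreover have "a \<noteq> 0" using assms True by (auto intro: ccontr)
    ultimately show ?thesis using yy * True
      by (simp add: zeta_neg_def y_def)
  next
    case False
    \<comment> \<open>Differentiation removes the constant \<open>1 / 2\<close>.\<close>
    have "fls_nth ((fls_deriv ^^ b) x_fls) n = fls_nth ((fls_deriv ^^ b) y) n" for n
    proof (cases "n + int b = 0")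
      case True
      then have "pochhammer (of_int (n + 1) :: rat) b = 0"
        using False unfolding pochhammer_eq_0_iff
        by (intro exI[of _ "b - 1"]) (auto simp: of_nat_diff)
      then show ?thesis by (simp add: fls_deriv_power_nth)
    next
      case False
      then show ?thesis by (simp add: fls_deriv_power_nth y_def)
    qed
    then have "(fls_deriv ^^ b) x_fls = (fls_deriv ^^ b) y" by (rule fls_eqI)
    then have "x_fls * (fls_deriv ^^ b) x_fls =
        y * (fls_deriv ^^ b) y - fls_const (1 / 2) * (fls_deriv ^^ b) x_fls"
      using x by (metis left_diff_distrib)
    then have "zeta_plus [a, b] =
        - (1 / 2) * (fact a * (pochhammer (of_nat (Suc a)) b * fls_nth x_fls (int (a + b))))"
      using * yy by (simp add: fls_deriv_power_nth add.commute)
    also have "fact a * (pochhammer (of_nat (Suc a)) b * fls_nth x_fls (int (a + b))) = zeta_neg (a + b)"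
      using pochhammer_product'[of "1 :: rat" a b]
      by (simp add: zeta_neg_def pochhammer_fact add.commute)
    finally show ?thesis using False by simp
  qed
qed

section \<open>The Riemann zeta function at nonpositive integers\<close>

text \<open>
  The error of the Taylor polynomial of degree \<open>N\<close> of \<open>(m + 1)\<^sup>\<alpha>\<close> at \<open>m\<close>.
\<close>

definition powr_taylor_remainder :: "nat \<Rightarrow> complex \<Rightarrow> nat \<Rightarrow> complex" where
  "powr_taylor_remainder N \<alpha> m =
     of_nat (Suc m) powr \<alpha> - (\<Sum>j\<le>N. (\<alpha> gchoose j) * of_nat m powr (\<alpha> - of_nat j))"

lemma powr_taylor_remainder_bound:
  assumes m: "m \<ge> 1" and Re: "Re \<alpha> \<le> real N + 1"
  shows "norm (powr_taylor_remainder N \<alpha> m) \<le>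
    real (N + 1) * norm (\<alpha> gchoose (N + 1)) * real m powr (Re \<alpha> - real N - 1)"
proof -
  let ?f = "\<lambda>i z. fact i * (\<alpha> gchoose i) * z powr (\<alpha> - of_nat i)"
  \<comment> \<open>Taylor's theorem is applied on the segment from \<open>m\<close> to \<open>m + 1\<close>, where the last derivative is largest at \<open>m\<close>.\<close>
  define S where "S = closed_segment (complex_of_real (real m)) (of_real (real m + 1))"
  have S: "\<exists>x. z = of_real x \<and> real m \<le> x \<and> x \<le> real m + 1" if "z \<in> S" for z
    using that unfolding S_def closed_segment_of_real by (auto simp: closed_segment_eq_real_ivl)
  have deriv: "(?f i has_field_derivative ?f (Suc i) z) (at z within S)" if "z \<in> S" "i \<le> N" for i z
  proof -
    obtain x where x: "z = of_real x" "real m \<le> x" using S[OF \<open>z \<in> S\<close>] by blast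
    then have "x > 0" using m by linarith
    then have "((\<lambda>z. z powr (\<alpha> - of_nat i)) has_field_derivative
        (\<alpha> - of_nat i) * z powr (\<alpha> - of_nat i - 1)) (at z within S)"
      using x by (intro has_field_derivative_at_within[OF has_field_derivative_powr])
        (auto simp: complex_nonpos_Reals_iff)
    then have "(?f i has_field_derivative fact i * (\<alpha> gchoose i) *
        ((\<alpha> - of_nat i) * z powr (\<alpha> - of_nat i - 1))) (at z within S)"
      by (rule DERIV_cmult)
    moreover have "fact (Suc i) * (\<alpha> gchoose (Suc i)) = fact i * (\<alpha> gchoose i) * (\<alpha> - of_nat i)"
      using of_nat_neq_0[of i, where ?'a = complex] by (simp add: gbinomial_prod_rev)
    moreover have "\<alpha> - of_nat i - 1 = \<alpha> - of_nat (Suc i)" by simp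
    ultimately show ?thesis by (simp only: mult.assoc)
  qed
  have bound: "norm (?f (Suc N) z) \<le>
      fact (N + 1) * norm (\<alpha> gchoose (N + 1)) * real m powr (Re \<alpha> - real N - 1)"
    if "z \<in> S" for z
  proof -
    obtain x where x: "z = of_real x" "real m \<le> x" using S[OF \<open>z \<in> S\<close>] by blast
    then have "x > 0" using m by linarith
    then have "norm (?f (Suc N) z) = fact (N + 1) * norm (\<alpha> gchoose (N + 1)) * x powr (Re \<alpha> - real N - 1)"
      using x by (simp add: norm_mult norm_powr_real_powr diff_diff_eq add.commute del: fact_Suc)
    also have "x powr (Re \<alpha> - real N - 1) \<le> real m powr (Re \<alpha> - real N - 1)"
      using x m Re by (intro powr_mono2') auto
    finally show ?thesis by (simp add: mult_left_mono del: fact_Suc)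
  qed
  have "convex S" "of_real (real m) \<in> S" "of_real (real m + 1) \<in> S"
    by (simp_all add: S_def)
  from complex_Taylor[where f = ?f, OF this(1) deriv bound this(2,3)]
  have "norm (?f 0 (of_real (real m + 1)) -
      (\<Sum>i\<le>N. ?f i (of_real (real m)) * (of_real (real m + 1) - of_real (real m)) ^ i / fact i))
    \<le> fact (N + 1) * norm (\<alpha> gchoose (N + 1)) * real m powr (Re \<alpha> - real N - 1) *
      norm (of_real (real m + 1) - of_real (real m) :: complex) ^ Suc N / fact N" .
  moreover have "(fact (N + 1) :: real) = real (N + 1) * fact N" by simp
  ultimately show ?thesis
    by (simp add: powr_taylor_remainder_def add.commute)
qed

lemma holomorphic_gbinomial [holomorphic_intros]:
  "f holomorphic_on A \<Longrightarrow> (\<lambda>z. f z gchoose n) holomorphic_on A"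
  unfolding gbinomial_prod_rev by (intro holomorphic_intros) auto

definition powr_taylor_sum :: "nat \<Rightarrow> complex \<Rightarrow> complex" where
  "powr_taylor_sum N \<alpha> = suminf (\<lambda>m. powr_taylor_remainder N \<alpha> (Suc m))"

lemma holomorphic_powr_taylor_sum:
  "powr_taylor_sum N holomorphic_on {\<alpha>. Re \<alpha> < real N}"
proof (rule holomorphic_uniform_sequence[where f = "\<lambda>n \<alpha>. \<Sum>m<n. powr_taylor_remainder N \<alpha> (Suc m)"])
  show "open {\<alpha>. Re \<alpha> < real N}" by (rule open_halfspace_Re_lt)
  show "(\<lambda>\<alpha>. \<Sum>m<n. powr_taylor_remainder N \<alpha> (Suc m)) holomorphic_on {\<alpha>. Re \<alpha> < real N}" for n
    unfolding powr_taylor_remainder_def by (intro holomorphic_intros)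
  fix \<beta> assume "\<beta> \<in> {\<alpha>. Re \<alpha> < real N}"
  then have \<beta>: "Re \<beta> < real N" by simp
  \<comment> \<open>With half the distance to the line \<open>Re \<alpha> = N\<close> as radius, the series is
     dominated by \<open>m\<^sup>-\<^sup>1\<^sup>-\<^sup>d\<close> on the disc.\<close>
  define d where "d = (real N - Re \<beta>) / 2"
  have d: "d > 0" using \<beta> by (simp add: d_def)
  have Re: "Re \<alpha> \<le> real N - d" if "\<alpha> \<in> cball \<beta> d" for \<alpha>
  proof -
    have "Re \<alpha> - Re \<beta> \<le> norm (\<alpha> - \<beta>)" using complex_Re_le_cmod[of "\<alpha> - \<beta>"] by simp
    also have "\<dots> \<le> d" using that by (simp add: dist_norm norm_minus_commute)
    finally have "Re \<alpha> - Re \<beta> \<le> d" .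
    moreover have "Re \<beta> = real N - 2 * d" unfolding d_def by argo
    ultimately show ?thesis by linarith
  qed
  have "continuous_on (cball \<beta> d) (\<lambda>\<alpha>. \<alpha> gchoose (N + 1))"
    by (intro holomorphic_on_imp_continuous_on holomorphic_intros)
  then have "bounded ((\<lambda>\<alpha>. \<alpha> gchoose (N + 1)) ` cball \<beta> d)"
    by (intro compact_imp_bounded compact_continuous_image) auto
  then obtain C where C: "\<And>\<alpha>. \<alpha> \<in> cball \<beta> d \<Longrightarrow> norm (\<alpha> gchoose (N + 1)) \<le> C"
    unfolding bounded_iff by blast
  have "uniform_limit (cball \<beta> d) (\<lambda>n \<alpha>. \<Sum>m<n. powr_taylor_remainder N \<alpha> (Suc m))
      (\<lambda>\<alpha>. suminf (\<lambda>m. powr_taylor_remainder N \<alpha> (Suc m))) sequentially"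
  proof (rule Weierstrass_m_test)
    fix m \<alpha> assume \<alpha>: "\<alpha> \<in> cball \<beta> d"
    have "norm (powr_taylor_remainder N \<alpha> (Suc m)) \<le>
        real (N + 1) * norm (\<alpha> gchoose (N + 1)) * real (Suc m) powr (Re \<alpha> - real N - 1)"
      using Re[OF \<alpha>] d by (intro powr_taylor_remainder_bound) auto
    also have "\<dots> \<le> real (N + 1) * C * real (Suc m) powr (- d - 1)"
    proof -
      have "0 \<le> C" using C[OF \<alpha>] norm_ge_zero order_trans by blast
      then show ?thesis
        using Re[OF \<alpha>] C[OF \<alpha>] by (intro mult_mono powr_mono) auto
    qed
    finally show "norm (powr_taylor_remainder N \<alpha> (Suc m)) \<le> real (N + 1) * C * real (Suc m) powr (- d - 1)" .
  next
    have "summable (\<lambda>m. real m powr (- d - 1))" using d by (simp add: summable_real_powr_iff)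
    then have "summable (\<lambda>m. real (Suc m) powr (- d - 1))" by (subst summable_Suc_iff)
    then show "summable (\<lambda>m. real (N + 1) * C * real (Suc m) powr (- d - 1))"
      by (rule summable_mult)
  qed
  moreover have "powr_taylor_sum N = (\<lambda>\<alpha>. suminf (\<lambda>m. powr_taylor_remainder N \<alpha> (Suc m)))"
    by (auto simp: powr_taylor_sum_def)
  moreover have "cball \<beta> d \<subseteq> {\<alpha>. Re \<alpha> < real N}"
    using Re d by force
  ultimately show "\<exists>d>0. cball \<beta> d \<subseteq> {\<alpha>. Re \<alpha> < real N} \<and>
      uniform_limit (cball \<beta> d) (\<lambda>n \<alpha>. \<Sum>m<n. powr_taylor_remainder N \<alpha> (Suc m)) (powr_taylor_sum N) sequentially"
    using d by auto
qed

text \<open>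
  For natural exponents the binomial expansion is finite and exact.
\<close>

lemma powr_taylor_sum_of_nat:
  assumes "n \<le> N"
  shows "powr_taylor_sum N (of_nat n) = 0"
proof -
  have "powr_taylor_remainder N (of_nat n) (Suc m) = 0" for m
  proof -
    have "(\<Sum>j\<le>N. (complex_of_nat n gchoose j) * of_nat (Suc m) powr (of_nat n - of_nat j)) =
        (\<Sum>j\<le>n. (complex_of_nat n gchoose j) * of_nat (Suc m) powr (of_nat n - of_nat j))"
      using assms by (intro sum.mono_neutral_right) (auto simp: binomial_gbinomial[symmetric] binomial_eq_0)
    also have "\<dots> = (\<Sum>j\<le>n. of_nat (n choose j) * 1 ^ j * of_nat (Suc m) ^ (n - j))"
      by (intro sum.cong refl) (simp add: binomial_gbinomial[symmetric] powr_nat' flip: of_nat_diff del: of_nat_Suc)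
    also have "\<dots> = (1 + of_nat (Suc m)) ^ n"
      by (rule binomial_ring[symmetric])
    finally show ?thesis
      by (simp add: powr_taylor_remainder_def powr_nat' del: of_nat_Suc) simp
  qed
  then show ?thesis by (simp add: powr_taylor_sum_def)
qed

lemma summable_norm_Suc_powr:
  assumes "Re s > 1"
  shows "summable (\<lambda>m. norm (of_nat (Suc m) powr (- s) :: complex))"
proof -
  have "summable (\<lambda>m. real m powr (- Re s))"
    using assms by (simp add: summable_real_powr_iff)
  then have "summable (\<lambda>m. real (Suc m) powr (- Re s))" by (subst summable_Suc_iff)
  then show ?thesis by (simp add: norm_powr_real_powr del: of_nat_Suc)
qed

lemma mzv_continuation1_has_sum:
  assumes Z: "mzv_continuation1 Z" and s: "Re s > 1"
  shows "((\<lambda>m. of_nat (Suc m) powr (- s)) has_sum Z s) UNIV"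
proof -
  let ?A = "{m :: nat list. length m = length [s] \<and> sorted_wrt (>) m \<and> (\<forall>i\<in>set m. 0 < i)}"
  have bij: "bij_betw (\<lambda>m. [Suc m]) UNIV ?A"
  proof (rule bij_betwI[where g = "\<lambda>l. hd l - 1"])
    show "(\<lambda>l. hd l - 1) \<in> ?A \<rightarrow> UNIV" by simp
    show "[Suc (hd l - 1)] = l" if "l \<in> ?A" for l
      using that by (auto simp: length_Suc_conv)
  qed auto
  have "(\<lambda>m. of_nat (Suc m) powr (- s) :: complex) summable_on UNIV"
    using summable_norm_Suc_powr[OF s] by (rule norm_summable_imp_summable_on)
  moreover have "Z s = mzv_series [s]"
    using Z s by (auto simp: mzv_continuation1_def mzv_region_def)
  moreover have "mzv_series [s] = (\<Sum>\<^sub>\<infinity>m. of_nat (Suc m) powr (- s))"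
    unfolding mzv_series_def infsum_reindex_bij_betw[OF bij, symmetric] by simp
  ultimately show ?thesis by (simp del: of_nat_Suc)
qed

text \<open>
  Summing \<open>(m + 1)\<^sup>\<alpha> - m\<^sup>\<alpha>\<close> over all \<open>m \<ge> 1\<close> telescopes to \<open>- 1\<close>; expanding each summand in powers of
  \<open>m\<close> turns the sum into zeta values at \<open>1 - \<alpha>, \<dots>, N - \<alpha>\<close>.
\<close>

lemma mzv_continuation1_recurrence_half_plane:
  assumes Z: "mzv_continuation1 Z" and \<alpha>: "Re \<alpha> < 0"
  shows "(\<Sum>j=1..N. (\<alpha> gchoose j) * Z (of_nat j - \<alpha>)) + powr_taylor_sum N \<alpha> = - 1"
proof -
  let ?p = "\<lambda>m. of_nat (Suc m) powr \<alpha> :: complex"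
  have lim: "?p \<longlonglongrightarrow> 0"
  proof (rule tendsto_norm_zero_cancel)
    have "(\<lambda>m. real m powr Re \<alpha>) \<longlonglongrightarrow> 0"
      using \<alpha> by (intro tendsto_neg_powr filterlim_real_sequentially)
    then have "(\<lambda>m. real (Suc m) powr Re \<alpha>) \<longlonglongrightarrow> 0" by (rule LIMSEQ_Suc)
    then show "(\<lambda>m. norm (?p m)) \<longlonglongrightarrow> 0"
      by (simp add: norm_powr_real_powr del: of_nat_Suc)
  qed
  have tele: "(\<lambda>m. ?p (Suc m) - ?p m) sums (0 - ?p 0)"
    by (rule telescope_sums[OF lim])
  have "(\<lambda>m. of_nat (Suc m) powr (- (of_nat j - \<alpha>))) sums Z (of_nat j - \<alpha>)" if "j \<in> {1..N}" for j
    using that \<alpha> by (intro has_sum_imp_sums mzv_continuation1_has_sum Z) auto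
  then have "(\<lambda>m. \<Sum>j=1..N. (\<alpha> gchoose j) * of_nat (Suc m) powr (- (of_nat j - \<alpha>))) sums
      (\<Sum>j=1..N. (\<alpha> gchoose j) * Z (of_nat j - \<alpha>))"
    by (intro sums_sum sums_mult)
  from sums_diff[OF tele this]
  have "(\<lambda>m. ?p (Suc m) - ?p m - (\<Sum>j=1..N. (\<alpha> gchoose j) * of_nat (Suc m) powr (- (of_nat j - \<alpha>))))
      sums (- 1 - (\<Sum>j=1..N. (\<alpha> gchoose j) * Z (of_nat j - \<alpha>)))"
    by simp
  moreover have "?p (Suc m) - ?p m - (\<Sum>j=1..N. (\<alpha> gchoose j) * of_nat (Suc m) powr (- (of_nat j - \<alpha>))) =
      powr_taylor_remainder N \<alpha> (Suc m)" for m
  proof -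
    have "{..N} = insert 0 {1..N}" by auto
    then show ?thesis by (simp add: powr_taylor_remainder_def del: of_nat_Suc)
  qed
  ultimately show ?thesis
    by (simp add: powr_taylor_sum_def sums_iff del: of_nat_Suc)
qed

text \<open>
  The excluded points are where one of the arguments \<open>j - \<alpha>\<close> hits the pole at \<open>1\<close>; away from them
  both sides are holomorphic, and the half plane minus finitely many points is connected.
\<close>

lemma mzv_continuation1_recurrence:
  assumes Z: "mzv_continuation1 Z" and \<alpha>: "Re \<alpha> < real N" "\<And>j::nat. \<alpha> \<noteq> of_nat j"
  shows "(\<Sum>j=1..N. (\<alpha> gchoose j) * Z (of_nat j - \<alpha>)) + powr_taylor_sum N \<alpha> = - 1"
proof (rule analytic_continuation_open[where
      f = "\<lambda>\<alpha>. (\<Sum>j=1..N. (\<alpha> gchoose j) * Z (of_nat j - \<alpha>)) + powr_taylor_sum N \<alpha>"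
      and g = "\<lambda>_. - 1"])
  let ?T = "(of_nat :: nat \<Rightarrow> complex) ` {..<N}"
  let ?H = "{\<alpha>. Re \<alpha> < real N}"
  show "open {\<alpha>. Re \<alpha> < 0}" by (rule open_halfspace_Re_lt)
  show "open (?H - ?T)" by (intro open_Diff open_halfspace_Re_lt finite_imp_closed) auto
  have "(- 1 :: complex) \<in> {\<alpha>. Re \<alpha> < 0}" by simp
  then show "{\<alpha>. Re \<alpha> < 0} \<noteq> {}" by blast
  show "connected (?H - ?T)"
    by (intro connected_open_delete_finite open_halfspace_Re_lt convex_connected convex_halfspace_Re_lt)
      simp_all
  show "{\<alpha>. Re \<alpha> < 0} \<subseteq> ?H - ?T" by auto
  show "\<alpha> \<in> ?H - ?T" using \<alpha> by auto
  have Zhol: "Z holomorphic_on - {1}" using Z by (simp add: mzv_continuation1_def)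
  have "(\<lambda>\<alpha>. Z (of_nat j - \<alpha>)) holomorphic_on (?H - ?T)" if "j \<in> {1..N}" for j
  proof -
    have "(Z \<circ> (\<lambda>\<alpha>. of_nat j - \<alpha>)) holomorphic_on (?H - ?T)"
    proof (rule holomorphic_on_compose_gen[OF _ Zhol])
      show "(\<lambda>\<alpha>. of_nat j - \<alpha>) ` (?H - ?T) \<subseteq> - {1}"
      proof clarify
        fix \<beta> :: complex assume \<beta>: "\<beta> \<notin> ?T" "of_nat j - \<beta> = 1"
        then have "\<beta> = of_nat (j - 1)" using that by (simp add: of_nat_diff algebra_simps)
        moreover have "j - 1 \<in> {..<N}" using that by auto
        ultimately show False using \<beta>(1) by blast
      qed
    qed (intro holomorphic_intros)
    then show ?thesis by (simp add: o_def)
  qed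
  moreover have "powr_taylor_sum N holomorphic_on (?H - ?T)"
    by (rule holomorphic_on_subset[OF holomorphic_powr_taylor_sum]) auto
  ultimately show "(\<lambda>\<alpha>. (\<Sum>j=1..N. (\<alpha> gchoose j) * Z (of_nat j - \<alpha>)) + powr_taylor_sum N \<alpha>) holomorphic_on (?H - ?T)"
    by (intro holomorphic_intros)
  show "(\<lambda>_. - 1 :: complex) holomorphic_on (?H - ?T)" by (intro holomorphic_intros)
qed (use mzv_continuation1_recurrence_half_plane[OF Z] in simp)

lemma eventually_at_of_nat_not_nat:
  "\<forall>\<^sub>F \<alpha> in at (of_nat n :: complex). \<forall>j::nat. \<alpha> \<noteq> of_nat j"
proof -
  have "\<forall>\<^sub>F \<alpha> in at (of_nat n :: complex). \<alpha> \<in> ball (of_nat n) 1 - {of_nat n}"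
    by (rule eventually_at_in_open) auto
  then show ?thesis
  proof eventually_elim
    case (elim \<alpha>)
    show ?case
    proof (intro allI notI)
      fix j :: nat assume j: "\<alpha> = of_nat j"
      have "norm (of_int (int n - int j) :: complex) < 1"
        using elim j by (simp add: dist_norm)
      then have "j = n" unfolding norm_of_int by linarith
      then show False using elim j by simp
    qed
  qed
qed

lemma tendsto_powr_taylor_sum:
  assumes "n < N"
  shows "powr_taylor_sum N \<midarrow>of_nat n\<rightarrow> 0"
proof -
  have "isCont (powr_taylor_sum N) (of_nat n)"
    using assms
    by (intro continuous_on_interior[OF holomorphic_on_imp_continuous_on[OF holomorphic_powr_taylor_sum[of N]]])
      (simp add: interior_open open_halfspace_Re_lt)
  then show ?thesis
    using assms by (simp add: isCont_def powr_taylor_sum_of_nat)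
qed

lemma mzv_continuation1_limit:
  assumes Z: "mzv_continuation1 Z" and n: "n < N"
  shows "(\<lambda>\<alpha>. \<Sum>j=1..N. (\<alpha> gchoose j) * Z (of_nat j - \<alpha>)) \<midarrow>of_nat n\<rightarrow> - 1"
proof (rule Lim_transform_eventually)
  show "(\<lambda>\<alpha>. - 1 - powr_taylor_sum N \<alpha>) \<midarrow>of_nat n\<rightarrow> - 1"
    using tendsto_diff[OF tendsto_const tendsto_powr_taylor_sum[OF n], of "- 1"] by simp
  have "\<forall>\<^sub>F \<alpha> in at (of_nat n :: complex). \<alpha> \<in> {\<alpha>. Re \<alpha> < real N} - {of_nat n}"
    using n by (intro eventually_at_in_open open_halfspace_Re_lt) auto
  with eventually_at_of_nat_not_nat
  show "\<forall>\<^sub>F \<alpha> in at (of_nat n). - 1 - powr_taylor_sum N \<alpha> = (\<Sum>j=1..N. (\<alpha> gchoose j) * Z (of_nat j - \<alpha>))"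
  proof eventually_elim
    case (elim \<alpha>)
    then show ?case using mzv_continuation1_recurrence[OF Z, of \<alpha> N] by (simp add: algebra_simps)
  qed
qed

text \<open>
  The pole of \<open>\<zeta>\<close> at \<open>1\<close> has residue \<open>1\<close>, written in the variable \<open>\<alpha> = 1 - s\<close>.
\<close>

lemma mzv_continuation1_residue:
  assumes Z: "mzv_continuation1 Z"
  shows "(\<lambda>\<alpha>. \<alpha> * Z (1 - \<alpha>)) \<midarrow>0\<rightarrow> - 1"
  using mzv_continuation1_limit[OF Z, of 0 1] by simp

text \<open>
  The telescoping identity with \<open>N = n + 1\<close> in the limit \<open>\<alpha> \<rightarrow> n\<close>. The remainder vanishes there, and in
  the last summand the zero of the binomial coefficient cancels the pole of \<open>\<zeta>\<close>, leaving
  \<open>- 1 / (n + 1)\<close>.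
\<close>

lemma mzv_continuation1_values:
  assumes Z: "mzv_continuation1 Z"
  shows "(\<Sum>j=1..n. of_nat (n choose j) * Z (of_nat j - of_nat n)) = 1 / of_nat (n + 1) - 1"
proof -
  let ?a = "of_nat n :: complex"
  have Zcont: "isCont Z s" if "s \<noteq> 1" for s
    using Z that holomorphic_on_imp_continuous_on[of Z "- {1}"]
    by (auto simp: mzv_continuation1_def continuous_on_eq_continuous_at open_Compl)
  have gcont: "isCont (\<lambda>\<alpha>::complex. \<alpha> gchoose j) \<alpha>" for j \<alpha>
  proof -
    have "continuous_on UNIV (\<lambda>\<alpha>::complex. \<alpha> gchoose j)"
      by (intro holomorphic_on_imp_continuous_on holomorphic_intros)
    then show ?thesis by (simp add: continuous_on_eq_continuous_at)
  qed
  have "(\<lambda>\<alpha>. (\<alpha> gchoose j) * Z (of_nat j - \<alpha>)) \<midarrow>?a\<rightarrow> (?a gchoose j) * Z (of_nat j - ?a)"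
    if "j \<in> {1..n}" for j
  proof -
    have "of_nat j - ?a \<noteq> 1"
    proof
      assume "of_nat j - ?a = 1"
      then have "of_nat j = (of_nat (n + 1) :: complex)" by (simp add: algebra_simps)
      then show False using that by (simp only: of_nat_eq_iff) simp
    qed
    then have "isCont (\<lambda>\<alpha>. Z (of_nat j - \<alpha>)) ?a"
      by (intro isCont_o2[OF _ Zcont] continuous_intros)
    then have "isCont (\<lambda>\<alpha>. (\<alpha> gchoose j) * Z (of_nat j - \<alpha>)) ?a"
      by (intro continuous_intros gcont)
    then show ?thesis by (simp add: isCont_def)
  qed
  then have 1: "(\<lambda>\<alpha>. \<Sum>j=1..n. (\<alpha> gchoose j) * Z (of_nat j - \<alpha>)) \<midarrow>?a\<rightarrow>
      (\<Sum>j=1..n. (?a gchoose j) * Z (of_nat j - ?a))"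
    by (rule tendsto_sum)
  have "(\<lambda>\<alpha>. (\<alpha> - ?a) * Z (1 - (\<alpha> - ?a))) \<midarrow>?a\<rightarrow> - 1"
    by (rule LIM_offset_zero_cancel) (use mzv_continuation1_residue[OF Z] in simp)
  then have "(\<lambda>\<alpha>. (\<alpha> gchoose n) / of_nat (n + 1) * ((\<alpha> - ?a) * Z (1 - (\<alpha> - ?a)))) \<midarrow>?a\<rightarrow>
      (?a gchoose n) / of_nat (n + 1) * - 1"
    using gcont[of ?a n] of_nat_neq_0[of n, where ?'a = complex]
    by (intro tendsto_intros) (simp_all add: isCont_def)
  moreover have "(\<alpha> gchoose n) / of_nat (n + 1) * ((\<alpha> - ?a) * Z (1 - (\<alpha> - ?a))) =
      (\<alpha> gchoose (Suc n)) * Z (of_nat (Suc n) - \<alpha>)" for \<alpha>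
  proof -
    have "(\<alpha> gchoose (Suc n)) = (\<alpha> gchoose n) / of_nat (n + 1) * (\<alpha> - ?a)"
      by (simp add: gbinomial_prod_rev)
    moreover have "1 - (\<alpha> - ?a) = of_nat (Suc n) - \<alpha>" by simp
    ultimately show ?thesis by (simp only: mult.assoc)
  qed
  ultimately have 2: "(\<lambda>\<alpha>. (\<alpha> gchoose (Suc n)) * Z (of_nat (Suc n) - \<alpha>)) \<midarrow>?a\<rightarrow> - (1 / of_nat (n + 1))"
    by (simp add: binomial_gbinomial[symmetric])
  have "(\<lambda>\<alpha>. \<Sum>j=1..Suc n. (\<alpha> gchoose j) * Z (of_nat j - \<alpha>)) \<midarrow>?a\<rightarrow>
      (\<Sum>j=1..n. (?a gchoose j) * Z (of_nat j - ?a)) + - (1 / of_nat (n + 1))"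
    using tendsto_add[OF 1 2] by simp
  from tendsto_unique[OF at_neq_bot this mzv_continuation1_limit[OF Z lessI]]
  have "(\<Sum>j=1..n. (?a gchoose j) * Z (of_nat j - ?a)) + - (1 / of_nat (n + 1)) = - 1" .
  then show ?thesis by (simp add: binomial_gbinomial[symmetric] algebra_simps)
qed

text \<open>
  Both sequences satisfy the same recurrence, in which the term \<open>j = 1\<close> contains the newest value with
  the nonzero coefficient \<open>k + 1\<close>.
\<close>

lemma zeta_neg_eq_continuation:
  assumes Z: "mzv_continuation1 Z"
  shows "of_rat (zeta_neg k) = Z (- of_nat k)"
proof (induction k rule: less_induct)
  case (less k)
  let ?z = "\<lambda>k. of_rat (zeta_neg k) :: complex"
  let ?n = "Suc k"
  have "of_rat (\<Sum>j=1..?n. of_nat (?n choose j) * zeta_neg (?n - j)) = (of_rat (1 / of_nat (?n + 1) - 1) :: complex)"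
    by (simp only: zeta_neg_recurrence)
  then have "(\<Sum>j=1..?n. of_nat (?n choose j) * ?z (?n - j)) = 1 / of_nat (?n + 1) - 1"
    by (simp only: of_rat_sum of_rat_mult of_rat_diff of_rat_divide of_rat_1 of_rat_of_nat_eq)
  also have "\<dots> = (\<Sum>j=1..?n. of_nat (?n choose j) * Z (of_nat j - of_nat ?n))"
    by (rule mzv_continuation1_values[OF Z, symmetric])
  finally have eq: "(\<Sum>j=1..?n. of_nat (?n choose j) * ?z (?n - j)) =
      (\<Sum>j=1..?n. of_nat (?n choose j) * Z (of_nat j - of_nat ?n))" .
  have "(\<Sum>j=2..?n. of_nat (?n choose j) * ?z (?n - j)) =
      (\<Sum>j=2..?n. of_nat (?n choose j) * Z (of_nat j - of_nat ?n))"
  proof (rule sum.cong[OF refl])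
    fix j assume j: "j \<in> {2..?n}"
    have "of_nat j - of_nat ?n = - (of_nat (?n - j) :: complex)"
      using j by (subst of_nat_diff) auto
    moreover have "?n - j < k" using j by auto
    ultimately show "of_nat (?n choose j) * ?z (?n - j) = of_nat (?n choose j) * Z (of_nat j - of_nat ?n)"
      using less[of "?n - j"] by (simp only:)
  qed
  moreover have "(\<Sum>j=1..?n. f j) = f 1 + (\<Sum>j=2..?n. f j)" for f :: "nat \<Rightarrow> complex"
    by (subst sum.atLeast_Suc_atMost) (auto simp: numeral_2_eq_2)
  ultimately have "of_nat (?n choose 1) * ?z (?n - 1) = of_nat (?n choose 1) * Z (of_nat 1 - of_nat ?n)"
    using eq by (simp only: add_right_cancel)
  then show ?case using of_nat_neq_0[of k, where ?'a = complex] by simp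
qed

section \<open>The double zeta function at a nonpositive integer second argument\<close>

lemma holomorphic2_on_slice:
  assumes "holomorphic2_on f U"
  shows "open {s. (s, c) \<in> U}" "(\<lambda>s. f (s, c)) holomorphic_on {s. (s, c) \<in> U}"
proof -
  have "open ((\<lambda>s. (s, c)) -` U)"
    using assms by (intro open_vimage continuous_intros) (simp add: holomorphic2_on_def)
  then show "open {s. (s, c) \<in> U}" by (simp add: vimage_def)
  show "(\<lambda>s. f (s, c)) holomorphic_on {s. (s, c) \<in> U}"
    unfolding holomorphic_on_def
  proof
    fix s assume "s \<in> {s. (s, c) \<in> U}"
    then obtain a b where "(f has_derivative (\<lambda>(h, k). a * h + b * k)) (at (s, c))"
      using assms by (auto simp: holomorphic2_on_def)
    moreover have "((\<lambda>s. (s, c)) has_derivative (\<lambda>h. (h, 0))) (at s within {s. (s, c) \<in> U})"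
      by (auto intro!: derivative_eq_intros)
    ultimately have "((\<lambda>s. f (s, c)) has_derivative (\<lambda>h. case (h, 0) of (h, k) \<Rightarrow> a * h + b * k))
        (at s within {s. (s, c) \<in> U})"
      by (rule has_derivative_compose[rotated])
    then have "((\<lambda>s. f (s, c)) has_field_derivative a) (at s within {s. (s, c) \<in> U})"
      by (simp add: has_field_derivative_def)
    then show "(\<lambda>s. f (s, c)) field_differentiable (at s within {s. (s, c) \<in> U})"
      by (auto simp: field_differentiable_def)
  qed
qed

text \<open>
  The outer index is shifted by one: \<open>m\<^sub>1 = m + 1\<close>, so that the inner index \<open>m\<^sub>2\<close> runs through
  \<open>1, \<dots>, m\<close>. The crude bound \<open>m\<^sub>1\<^bsup>b+1\<^esup>\<close> for the inner sum suffices for absolute convergence.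
\<close>

lemma mzv_series_depth_2_sums:
  assumes t: "Re t > real b + 2"
  shows "(\<lambda>m. of_nat (Suc m) powr (- t) * (\<Sum>n=1..m. of_nat n ^ b)) sums mzv_series [t, - of_nat b]"
proof -
  let ?A = "{m :: nat list. length m = length [t, - of_nat b] \<and> sorted_wrt (>) m \<and> (\<forall>i\<in>set m. 0 < i)}"
  let ?S = "Sigma UNIV (\<lambda>m :: nat. {1..m})"
  let ?f = "\<lambda>m n. of_nat (Suc m) powr (- t) * of_nat n ^ b :: complex"
  have bij: "bij_betw (\<lambda>(m, n). [Suc m, n]) ?S ?A"
  proof (rule bij_betwI[where g = "\<lambda>l. (hd l - 1, l ! 1)"])
    show "(\<lambda>(m, n). [Suc m, n]) \<in> ?S \<rightarrow> ?A" by auto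
    show "(\<lambda>l. (hd l - 1, l ! 1)) \<in> ?A \<rightarrow> ?S"
      by (auto simp: length_Suc_conv numeral_2_eq_2)
    show "(case (hd l - 1, l ! 1) of (m, n) \<Rightarrow> [Suc m, n]) = l" if "l \<in> ?A" for l
      using that by (auto simp: length_Suc_conv)
  qed auto
  have series: "mzv_series [t, - of_nat b] = (\<Sum>\<^sub>\<infinity>(m, n)\<in>?S. ?f m n)"
    unfolding mzv_series_def infsum_reindex_bij_betw[OF bij, symmetric]
    by (intro infsum_cong) (auto simp: powr_nat' lessThan_Suc simp del: of_nat_Suc)
  have inner: "(\<Sum>\<^sub>\<infinity>n\<in>{1..m}. norm (?f m n)) \<le> real (Suc m) powr (real b + 1 - Re t)" for m
  proof -
    have "(\<Sum>\<^sub>\<infinity>n\<in>{1..m}. norm (?f m n)) = real (Suc m) powr (- Re t) * (\<Sum>n=1..m. real n ^ b)"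
      by (simp add: norm_mult norm_power norm_powr_real_powr sum_distrib_left del: of_nat_Suc)
    also have "(\<Sum>n=1..m. real n ^ b) \<le> of_nat (card {1..m}) * real (Suc m) ^ b"
      by (rule sum_bounded_above) (auto intro!: power_mono)
    also have "\<dots> \<le> real (Suc m) ^ (b + 1)" by (simp add: mult_right_mono)
    also have "\<dots> = real (Suc m) powr (real b + 1)"
      using powr_realpow[of "real (Suc m)" "b + 1"] by (simp add: add.commute)
    finally show ?thesis
      by (simp add: mult_left_mono algebra_simps flip: powr_add del: of_nat_Suc)
  qed
  have "(\<lambda>p. norm ((\<lambda>(m, n). ?f m n) p)) summable_on ?S"
    unfolding Infinite_Sum.abs_summable_on_Sigma_iff
  proof (intro conjI ballI)
    show "(\<lambda>n. norm ((\<lambda>(m, n). ?f m n) (m, n))) summable_on {1..m}" for m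
      by (rule summable_on_finite) simp
    have "summable (\<lambda>m. real m powr (real b + 1 - Re t))"
      using t by (simp add: summable_real_powr_iff)
    then have "summable (\<lambda>m. real (Suc m) powr (real b + 1 - Re t))" by (subst summable_Suc_iff)
    then have "(\<lambda>m. norm (real (Suc m) powr (real b + 1 - Re t))) summable_on UNIV"
      by (intro norm_summable_imp_summable_on) simp
    then show "(\<lambda>m. norm (\<Sum>\<^sub>\<infinity>n\<in>{1..m}. norm ((\<lambda>(m, n). ?f m n) (m, n)))) summable_on UNIV"
    proof (rule Infinite_Sum.abs_summable_on_comparison_test)
      fix m :: nat
      have "0 \<le> (\<Sum>\<^sub>\<infinity>n\<in>{1..m}. norm (?f m n))" by (rule infsum_nonneg) simp
      then show "norm (\<Sum>\<^sub>\<infinity>n\<in>{1..m}. norm ((\<lambda>(m, n). ?f m n) (m, n))) \<le>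
          norm (real (Suc m) powr (real b + 1 - Re t))"
        using inner[of m] by (simp del: of_nat_Suc infsum_finite)
    qed
  qed
  then have "(\<lambda>(m, n). ?f m n) summable_on ?S" by (rule Infinite_Sum.abs_summable_summable)
  from infsum_Sigma'_banach[OF this] summable_on_Sigma_banach[OF this]
  have iterated: "(\<Sum>\<^sub>\<infinity>m. \<Sum>n=1..m. ?f m n) = (\<Sum>\<^sub>\<infinity>(m, n)\<in>?S. ?f m n)"
    and summable: "(\<lambda>m. \<Sum>n=1..m. ?f m n) summable_on UNIV"
    by (simp_all del: of_nat_Suc)
  from has_sum_imp_sums[OF has_sum_infsum[OF summable]] show ?thesis
    by (simp only: series iterated sum_distrib_left)
qed

text \<open>
  Faulhaber's formula in terms of the strict upper bound \<open>m + 1\<close>, which is the summation index of the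
  outer series; its last power is therefore subtracted.
\<close>

lemma complex_sum_powers:
  "(\<Sum>n=1..m. (of_nat n :: complex) ^ b) = of_nat (Suc m) ^ (b + 1) / of_nat (b + 1) -
     (\<Sum>j=1..b. of_nat (b choose j) * of_rat (zeta_neg (b - j)) * of_nat (Suc m) ^ j) - of_nat (Suc m) ^ b"
proof -
  have "of_rat (\<Sum>n=1..Suc m. of_nat n ^ b) = (of_rat (of_nat (Suc m) ^ (b + 1) / of_nat (b + 1) -
      (\<Sum>j=1..b. of_nat (b choose j) * zeta_neg (b - j) * of_nat (Suc m) ^ j)) :: complex)"
    by (simp only: sum_powers)
  then have "(\<Sum>n=1..Suc m. (of_nat n :: complex) ^ b) = of_nat (Suc m) ^ (b + 1) / of_nat (b + 1) -
      (\<Sum>j=1..b. of_nat (b choose j) * of_rat (zeta_neg (b - j)) * of_nat (Suc m) ^ j)"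
    by (simp only: of_rat_sum of_rat_mult of_rat_diff of_rat_divide of_rat_power of_rat_of_nat_eq)
  then show ?thesis by (simp add: algebra_simps)
qed

lemma mzv_series_depth_2:
  assumes Z: "mzv_continuation1 Z" and t: "Re t > real b + 2"
  shows "mzv_series [t, - of_nat b] = Z (t - of_nat (b + 1)) / of_nat (b + 1) -
    (\<Sum>j=1..b. of_nat (b choose j) * of_rat (zeta_neg (b - j)) * Z (t - of_nat j)) - Z (t - of_nat b)"
proof -
  have p: "(\<lambda>m. of_nat (Suc m) powr (- t) * of_nat (Suc m) ^ j) sums Z (t - of_nat j)" if "j \<le> b + 1" for j
  proof -
    have "(\<lambda>m. of_nat (Suc m) powr (- (t - of_nat j))) sums Z (t - of_nat j)"
      using that t by (intro has_sum_imp_sums mzv_continuation1_has_sum Z) auto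
    moreover have "of_nat (Suc m) powr (- (t - of_nat j)) = of_nat (Suc m) powr (- t) * (of_nat (Suc m) ^ j :: complex)" for m
    proof -
      have "- (t - of_nat j) = - t + of_nat j" by simp
      then show ?thesis by (simp only: powr_add) (simp add: powr_nat' del: of_nat_Suc)
    qed
    ultimately show ?thesis by (simp only:)
  qed
  have "(\<lambda>m. of_nat (Suc m) powr (- t) * of_nat (Suc m) ^ (b + 1) / of_nat (b + 1) -
      (\<Sum>j=1..b. of_nat (b choose j) * of_rat (zeta_neg (b - j)) * (of_nat (Suc m) powr (- t) * of_nat (Suc m) ^ j)) -
      of_nat (Suc m) powr (- t) * of_nat (Suc m) ^ b) sums
    (Z (t - of_nat (b + 1)) / of_nat (b + 1) -
    (\<Sum>j=1..b. of_nat (b choose j) * of_rat (zeta_neg (b - j)) * Z (t - of_nat j)) - Z (t - of_nat b))"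
    by (intro sums_diff sums_divide sums_sum sums_mult p) auto
  moreover have "of_nat (Suc m) powr (- t) * of_nat (Suc m) ^ (b + 1) / of_nat (b + 1) -
      (\<Sum>j=1..b. of_nat (b choose j) * of_rat (zeta_neg (b - j)) * (of_nat (Suc m) powr (- t) * of_nat (Suc m) ^ j)) -
      of_nat (Suc m) powr (- t) * of_nat (Suc m) ^ b = of_nat (Suc m) powr (- t) * (\<Sum>n=1..m. of_nat n ^ b)" for m
    unfolding complex_sum_powers
    by (simp only: right_diff_distrib sum_distrib_left times_divide_eq_right mult.left_commute mult.assoc)
  ultimately have "(\<lambda>m. of_nat (Suc m) powr (- t) * (\<Sum>n=1..m. of_nat n ^ b)) sums
    (Z (t - of_nat (b + 1)) / of_nat (b + 1) -
    (\<Sum>j=1..b. of_nat (b choose j) * of_rat (zeta_neg (b - j)) * Z (t - of_nat j)) - Z (t - of_nat b))"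
    by (simp only:)
  with mzv_series_depth_2_sums[OF t] show ?thesis by (rule sums_unique2)
qed

text \<open>
  On the line \<open>s\<^sub>2 = - b\<close> the identity theorem in one variable applies. The singular hyperplanes of
  \<open>\<zeta>\<^sub>2\<close> meet this line in countably many points, and the complement of a countable set in the plane is
  connected.
\<close>

lemma mzv_continuation2_slice:
  assumes Z1: "mzv_continuation1 Z1" and Z2: "mzv_continuation2 Z2"
    and t: "(t, - of_nat b) \<notin> mzv_sing2" "t \<notin> of_nat ` {1..b + 2}"
  shows "Z2 (t, - of_nat b) = Z1 (t - of_nat (b + 1)) / of_nat (b + 1) -
    (\<Sum>j=1..b. of_nat (b choose j) * of_rat (zeta_neg (b - j)) * Z1 (t - of_nat j)) - Z1 (t - of_nat b)"
proof -
  let ?S = "{t. (t, - of_nat b) \<in> mzv_sing2}"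
  let ?T = "(of_nat :: nat \<Rightarrow> complex) ` {1..b + 2}"
  let ?U = "- (?S \<union> ?T)"
  let ?H = "{t :: complex. real b + 2 < Re t}"
  let ?g = "\<lambda>t. Z1 (t - of_nat (b + 1)) / of_nat (b + 1) -
    (\<Sum>j=1..b. of_nat (b choose j) * of_rat (zeta_neg (b - j)) * Z1 (t - of_nat j)) - Z1 (t - of_nat b)"
  have hol2: "holomorphic2_on Z2 (- mzv_sing2)" using Z2 by (simp add: mzv_continuation2_def)
  have U: "?U = {t. (t, - of_nat b) \<in> - mzv_sing2} - ?T" by auto
  show ?thesis
  proof (rule analytic_continuation_open[where f = "\<lambda>t. Z2 (t, - of_nat b)" and g = ?g])
    show "open ?H" by (rule open_halfspace_Re_gt)
    show "open ?U"
      unfolding U by (intro open_Diff holomorphic2_on_slice[OF hol2] finite_imp_closed) simp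
    have "of_nat (b + 3) \<in> ?H" by simp
    then show "?H \<noteq> {}" by blast
    have "?S \<subseteq> {1, of_nat b + 2, of_nat b + 1} \<union> range (\<lambda>j. of_nat b - 2 * of_nat j)"
      by (auto simp: mzv_sing2_def algebra_simps)
    moreover have "countable \<dots>" by simp
    ultimately have "countable ?S" by (rule countable_subset)
    then show "connected ?U"
      by (intro path_connected_imp_connected path_connected_complement_countable) auto
    show "?H \<subseteq> ?U"
      by (auto simp: mzv_sing2_def complex_eq_iff)
    show "(\<lambda>t. Z2 (t, - of_nat b)) holomorphic_on ?U"
      unfolding U by (rule holomorphic_on_subset[OF holomorphic2_on_slice(2)[OF hol2]]) auto
    have hol: "(\<lambda>t. Z1 (t - of_nat j)) holomorphic_on ?U" if "j \<le> b + 1" for j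
    proof -
      have "(Z1 \<circ> (\<lambda>t. t - of_nat j)) holomorphic_on ?U"
      proof (rule holomorphic_on_compose_gen[where t = "- {1}"])
        show "Z1 holomorphic_on - {1}" using Z1 by (simp add: mzv_continuation1_def)
        show "(\<lambda>t. t - of_nat j) ` ?U \<subseteq> - {1}"
        proof (rule image_subsetI, rule ComplI)
          fix t :: complex assume "t \<in> ?U" and "t - of_nat j \<in> {1}"
          moreover from this have "t = of_nat (Suc j)" by (simp add: algebra_simps)
          moreover have "Suc j \<in> {1..b + 2}" using that by simp
          ultimately show False by blast
        qed
      qed (intro holomorphic_intros)
      then show ?thesis by (simp add: o_def)
    qed
    show "?g holomorphic_on ?U"
      by (intro holomorphic_intros hol) auto
    show "Z2 (t, - of_nat b) = ?g t" if "t \<in> ?H" for t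
    proof -
      have "mzv_region [t, - of_nat b]"
        using that by (auto simp: mzv_region_def numeral_2_eq_2 atLeastAtMostSuc_conv)
      then have "Z2 (t, - of_nat b) = mzv_series [t, - of_nat b]"
        using Z2 by (simp add: mzv_continuation2_def)
      then show ?thesis using mzv_series_depth_2[OF Z1, of b t] that by simp
    qed
    show "t \<in> ?U" using t by simp
  qed
qed

text \<open>
  In every product in the sum over \<open>j\<close> with \<open>j < b\<close> exactly one of the indices \<open>b - j\<close> and \<open>a + j\<close> is
  even, and it is positive, so that the product vanishes; so does \<open>\<zeta>(- a - b - 1)\<close>. Only \<open>- \<zeta>(- a - b)\<close> and, for \<open>b > 0\<close>, the
  term \<open>j = b\<close> with \<open>\<zeta>(0) = - 1 / 2\<close> remain.
\<close>

lemma mzv_continuation2_values: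
  assumes Z1: "mzv_continuation1 Z1" and Z2: "mzv_continuation2 Z2" and odd: "odd (a + b)"
  shows "Z2 (- of_nat a, - of_nat b) = of_rat ((if b = 0 then - 1 else - (1 / 2)) * zeta_neg (a + b))"
proof -
  let ?z = "\<lambda>k. of_rat (zeta_neg k) :: complex"
  have "(- of_nat a, - of_nat b) \<notin> mzv_sing2"
  proof
    assume "(- of_nat a, - of_nat b) \<in> mzv_sing2"
    then have "of_int (- int a) = (of_int 1 :: complex) \<or>
        of_int (- int b - int a) = (of_int 2 :: complex) \<or> of_int (- int b - int a) = (of_int 1 :: complex) \<or>
        (\<exists>j :: nat. of_int (- int b - int a) = (of_int (- 2 * int j) :: complex))"
      by (simp add: mzv_sing2_def)
    then show False
      unfolding of_int_eq_iff using odd by presburger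
  qed
  moreover have "- of_nat a \<notin> (of_nat :: nat \<Rightarrow> complex) ` {1..b + 2}"
  proof clarify
    fix k assume "k \<in> {1..b + 2}" and "- of_nat a = (of_nat k :: complex)"
    then have "of_int (- int a) = (of_int (int k) :: complex)" by simp
    then show False using \<open>k \<in> {1..b + 2}\<close> unfolding of_int_eq_iff by simp
  qed
  ultimately have "Z2 (- of_nat a, - of_nat b) = Z1 (- of_nat a - of_nat (b + 1)) / of_nat (b + 1) -
      (\<Sum>j=1..b. of_nat (b choose j) * ?z (b - j) * Z1 (- of_nat a - of_nat j)) - Z1 (- of_nat a - of_nat b)"
    by (rule mzv_continuation2_slice[OF Z1 Z2])
  moreover have "Z1 (- of_nat a - of_nat j) = ?z (a + j)" for j
    using zeta_neg_eq_continuation[OF Z1, of "a + j"] by simp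
  ultimately have *: "Z2 (- of_nat a, - of_nat b) = ?z (a + (b + 1)) / of_nat (b + 1) -
      (\<Sum>j=1..b. of_nat (b choose j) * ?z (b - j) * ?z (a + j)) - ?z (a + b)"
    by (simp only:)
  have "zeta_neg (a + (b + 1)) = 0"
    using odd by (intro zeta_neg_even_eq_0) auto
  moreover have "zeta_neg (b - j) * zeta_neg (a + j) = 0" if "j \<in> {1..b} - {b}" for j
  proof (cases "even (b - j)")
    case True
    then show ?thesis using that zeta_neg_even_eq_0[of "b - j"] by simp
  next
    case False
    then have "even (a + j)" using odd that by simp
    then show ?thesis using that zeta_neg_even_eq_0[of "a + j"] by simp
  qed
  then have "(\<Sum>j=1..b. of_nat (b choose j) * ?z (b - j) * ?z (a + j)) =
      (\<Sum>j\<in>(if b = 0 then {} else {b}). of_nat (b choose j) * ?z (b - j) * ?z (a + j))"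
    by (intro sum.mono_neutral_right) (auto simp: mult.assoc simp flip: of_rat_mult split: if_splits)
  ultimately show ?thesis
    using * by (simp add: zeta_neg_0 of_rat_mult of_rat_minus of_rat_divide)
qed

theorem theorem4p3:
  fixes zeta1 :: "complex \<Rightarrow> complex" and zeta2 :: "complex \<times> complex \<Rightarrow> complex"
  assumes "mzv_continuation1 zeta1" and "mzv_continuation2 zeta2"
  shows "(\<forall>k::nat. of_rat (zeta_plus [k]) = zeta1 (- of_nat k)) \<and>
    (\<forall>a b::nat. odd (a + b) \<longrightarrow> of_rat (zeta_plus [a, b]) = zeta2 (- of_nat a, - of_nat b))"
  using assms
  by (simp add: zeta_plus_depth_1 zeta_plus_depth_2 zeta_neg_eq_continuation mzv_continuation2_values)

end
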